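(* Let $\mathbb{T}$ be a time scale, $\alpha\in(0,1]$, $t_0\in\mathbb{T}^{\kappa}$, and $\gamma\in\mathbb{R}\setminus\{0\}$. Let $\kappa_0,\kappa_1$ be an admissible pair on $\mathbb{T}$, let $\Delta^{\alpha}f=\kappa_1(\alpha,\cdot)f+\kappa_0(\alpha,\cdot)f^{\Delta}$, and suppose $\kappa_0^{2}-2\mu\kappa_0\kappa_1+\mu^{2}(-\gamma^{2}+\kappa_1^{2})\neq0$ for all $t\in\mathbb{T}^\kappa$, where $\kappa_i=\kappa_i(\alpha,t)$, $\mu=\mu(t)$. Then $$y(t)=c_1\cosh_{\gamma\Delta^{\alpha}}(t,t_0)+c_2\sinh_{\gamma\Delta^{\alpha}}(t,t_0),$$ where $c_1$ and $c_2$ are arbitrary constants, is a general solution of $$\Delta^{\alpha}\Delta^{\alpha}y-\gamma^{2}y=0\qquad\text{on } t\in\mathbb{T}^{\kappa^2}_{[t_0,\infty)};$$ that is, every function of this form is a solution and every solution is of this form.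
   Context: A time scale $\mathbb{T}$ is a nonempty closed subset of $\mathbb{R}$, with forward jump $\sigma(t)=\inf\{s\in\mathbb{T}:s>t\}$, backward jump $\rho(t)=\sup\{s\in\mathbb{T}:s<t\}$ (usual conventions $\inf\emptyset=\sup\mathbb{T}$, $\sup\emptyset=\inf\mathbb{T}$) and graininess $\mu(t)=\sigma(t)-t$. A point $t$ is right-dense if $t<\sup\mathbb{T}$ and $\sigma(t)=t$, left-dense if $t>\inf\mathbb{T}$ and $\rho(t)=t$, left-scattered if $\rho(t)<t$. $\mathbb{T}^{\kappa}=\mathbb{T}\setminus\{m\}$ if $\mathbb{T}$ has a left-scattered maximum $m$, and $\mathbb{T}^{\kappa}=\mathbb{T}$ otherwise; $\mathbb{T}^{\kappa^2}=(\mathbb{T}^\kappa)^\kappa$. A subscript $[t_0,\infty)$ denotes intersection with $[t_0,\infty)$. Delta derivative: for $t\in\mathbb{T}^\kappa$, $f^{\Delta}(t)$ is the number (if it exists) such that for every $\epsilon>0$ there is $\delta>0$ with $|[f(\sigma(t))-f(s)]-f^{\Delta}(t)[\sigma(t)-s]|\le\epsilon|\sigma(t)-s|$ for all $s\in(t-\delta,t+\delta)\cap\mathbb{T}$. A function on $\mathbb{T}$ is rd-continuous if it is continuous at right-dense points and has finite left-sided limits at left-dense points. A function $k:[0,1]\times\mathbb{T}\to[0,\infty)$ is rd-continuous if $k(\alpha,\cdot)$ is rd-continuous for every $\alpha\in[0,1]$ and $k(\cdot,t)$ is continuous on $[0,1]$ for every $t\in\mathbb{T}$. Admissible pair: rd-continuous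 $\kappa_0,\kappa_1:[0,1]\times\mathbb{T}\to[0,\infty)$ such that for all $t\in\mathbb{T}$: $\lim_{\alpha\to0^+}\kappa_1(\alpha,t)=1$, $\lim_{\alpha\to0^+}\kappa_0(\alpha,t)=0$, $\lim_{\alpha\to1^-}\kappa_1(\alpha,t)=0$, $\lim_{\alpha\to1^-}\kappa_0(\alpha,t)=1$, $\kappa_1(\alpha,t)\ne0$ for $\alpha\in[0,1)$, $\kappa_0(\alpha,t)\neq0$ for $\alpha\in(0,1]$. Exponentials: $e_q(t,s)=\exp\left(\int_s^t\xi_{\mu(\tau)}(q(\tau))\Delta\tau\right)$ (delta integral) denotes the usual exponential function on the time scale, with $\xi_h(z)=\frac1h\mathrm{Log}(1+hz)$ for $h>0$ ($\mathrm{Log}$ the principal logarithm) and $\xi_0(z)=z$. For $s\le t$ in $\mathbb{T}$, the conformable exponential is $E_p(t,s)=e_q(t,s)$ with $q=\frac{p-\kappa_1(\alpha,\cdot)}{\kappa_0(\alpha,\cdot)}$, for rd-continuous $p$ with $1+\mu q\neq0$ on $\mathbb{T}^\kappa$. The condition assumed in the theorem is equivalent to this nonvanishing for both $p\equiv\gamma$ and $p\equiv-\gamma$, and $$\cosh_{\gamma\Delta^{\alpha}}(\cdot,t_0)=\frac{E_\gamma(\cdot,t_0)+E_{-\gamma}(\cdot,t_0)}{2},\qquad \sinh_{\gamma\Delta^{\alpha}}(\cdot,t_0)=\frac{E_\gamma(\cdot,t_0)-E_{-\gamma}(\cdot,t_0)}{2}\quad\text{on }\mathbb{T}_{[t_0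,\infty)}.$$
   Formalization: Added: the rates (±γ−κ1)/κ0 are rd-continuous on T (else the exponentials may be undefined), and κ0(α,·), κ1(α,·) are continuous at the maximum of T^κ if it is left-dense (else combinations can fail to solve the equation there). *)

theory Defs
  imports "HOL-Analysis.Analysis"
begin

definition time_scale :: "real set \<Rightarrow> bool" where
  "time_scale T \<longleftrightarrow> closed T \<and> T \<noteq> {}"

text \<open>
  The case distinctions are the conventions \<open>inf \<emptyset> = sup T\<close> and \<open>sup \<emptyset> = inf T\<close>. They are
  only reached at points of \<open>T\<close> that are its maximum (minimum), where the real-valued
  \<^const>\<open>Sup\<close> (\<^const>\<open>Inf\<close>) is meaningful.
\<close>

definition fwd_jump :: "real set \<Rightarrow> real \<Rightarrow> real" where
  "fwd_jump T t = (if {s \<in> T. t < s} = {} then Sup T else Inf {s \<in> T. t < s})"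

definition bwd_jump :: "real set \<Rightarrow> real \<Rightarrow> real" where
  "bwd_jump T t = (if {s \<in> T. s < t} = {} then Inf T else Sup {s \<in> T. s < t})"

definition graininess :: "real set \<Rightarrow> real \<Rightarrow> real" where
  "graininess T t = fwd_jump T t - t"

text \<open>
  \<open>t < sup T\<close> and \<open>t > inf T\<close> are written as existence of a larger (smaller) point, because
  \<open>T\<close> may be unbounded. In particular a maximum of \<open>T\<close> is never right-dense.
\<close>

definition right_dense :: "real set \<Rightarrow> real \<Rightarrow> bool" where
  "right_dense T t \<longleftrightarrow> (\<exists>s\<in>T. t < s) \<and> fwd_jump T t = t"

definition left_dense :: "real set \<Rightarrow> real \<Rightarrow> bool" where
  "left_dense T t \<longleftrightarrow> (\<exists>s\<in>T. s < t) \<and> bwd_jump T t = t"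

definition left_scattered :: "real set \<Rightarrow> real \<Rightarrow> bool" where
  "left_scattered T t \<longleftrightarrow> bwd_jump T t < t"

definition ts_kappa :: "real set \<Rightarrow> real set" where
  "ts_kappa T = T - {m \<in> T. (\<forall>s\<in>T. s \<le> m) \<and> left_scattered T m}"

text \<open>
  The derivative is a relation. The number \<open>d\<close> is unique except at a left-scattered maximum of
  \<open>T\<close> and on a one-point time scale, where the condition holds for every \<open>d\<close>.
\<close>

definition has_delta_derivative ::
    "real set \<Rightarrow> (real \<Rightarrow> 'a::real_normed_vector) \<Rightarrow> 'a \<Rightarrow> real \<Rightarrow> bool" where
  "has_delta_derivative T f d t \<longleftrightarrow>
     (\<forall>\<epsilon>>0. \<exists>\<delta>>0. \<forall>s \<in> {t - \<delta> <..< t + \<delta>} \<inter> T.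
        norm ((f (fwd_jump T t) - f s) - (fwd_jump T t - s) *\<^sub>R d) \<le> \<epsilon> * \<bar>fwd_jump T t - s\<bar>)"

definition rd_continuous :: "real set \<Rightarrow> (real \<Rightarrow> real) \<Rightarrow> bool" where
  "rd_continuous T f \<longleftrightarrow>
     (\<forall>t\<in>T. right_dense T t \<longrightarrow> continuous (at t within T) f) \<and>
     (\<forall>t\<in>T. left_dense T t \<longrightarrow> (\<exists>l. (f \<longlongrightarrow> l) (at t within (T \<inter> {..<t}))))"

definition rd_continuous2 :: "real set \<Rightarrow> (real \<Rightarrow> real \<Rightarrow> real) \<Rightarrow> bool" where
  "rd_continuous2 T k \<longleftrightarrow>
     (\<forall>\<alpha>\<in>{0..1}. rd_continuous T (k \<alpha>)) \<and> (\<forall>t\<in>T. continuous_on {0..1} (\<lambda>\<alpha>. k \<alpha> t))"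

definition admissible_pair ::
    "real set \<Rightarrow> (real \<Rightarrow> real \<Rightarrow> real) \<Rightarrow> (real \<Rightarrow> real \<Rightarrow> real) \<Rightarrow> bool" where
  "admissible_pair T \<kappa>0 \<kappa>1 \<longleftrightarrow>
     rd_continuous2 T \<kappa>0 \<and> rd_continuous2 T \<kappa>1 \<and>
     (\<forall>\<alpha>\<in>{0..1}. \<forall>t\<in>T. 0 \<le> \<kappa>0 \<alpha> t \<and> 0 \<le> \<kappa>1 \<alpha> t) \<and>
     (\<forall>t\<in>T.
        ((\<lambda>\<alpha>. \<kappa>1 \<alpha> t) \<longlongrightarrow> 1) (at_right 0) \<and> ((\<lambda>\<alpha>. \<kappa>0 \<alpha> t) \<longlongrightarrow> 0) (at_right 0) \<and>
        ((\<lambda>\<alpha>. \<kappa>1 \<alpha> t) \<longlongrightarrow> 0) (at_left 1) \<and> ((\<lambda>\<alpha>. \<kappa>0 \<alpha> t) \<longlongrightarrow> 1) (at_left 1) \<and>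
        (\<forall>\<alpha>\<in>{0..<1}. \<kappa>1 \<alpha> t \<noteq> 0) \<and> (\<forall>\<alpha>\<in>{0<..1}. \<kappa>0 \<alpha> t \<noteq> 0))"

text \<open>
  The Cauchy delta integral: the increment of a delta antiderivative on \<open>T\<close>. Antiderivatives
  are unique up to a constant, so the increment does not depend on the choice. An rd-continuous
  integrand has an antiderivative if it is also continuous at a left-dense maximum of \<open>T\<close>.
\<close>

definition delta_antiderivative ::
    "real set \<Rightarrow> (real \<Rightarrow> 'a::real_normed_vector) \<Rightarrow> (real \<Rightarrow> 'a) \<Rightarrow> bool" where
  "delta_antiderivative T f F \<longleftrightarrow> (\<forall>t\<in>ts_kappa T. has_delta_derivative T F (f t) t)"

definition delta_integral ::
    "real set \<Rightarrow> (real \<Rightarrow> 'a::real_normed_vector) \<Rightarrow> real \<Rightarrow> real \<Rightarrow> 'a" where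
  "delta_integral T f s t = (THE I. \<exists>F. delta_antiderivative T f F \<and> I = F t - F s)"

definition cylinder :: "real \<Rightarrow> complex \<Rightarrow> complex" where
  "cylinder h z = (if h = 0 then z else Ln (1 + of_real h * z) / of_real h)"

definition ts_exp :: "real set \<Rightarrow> (real \<Rightarrow> real) \<Rightarrow> real \<Rightarrow> real \<Rightarrow> complex" where
  "ts_exp T q t s =
     exp (delta_integral T (\<lambda>\<tau>. cylinder (graininess T \<tau>) (complex_of_real (q \<tau>))) s t)"

definition conf_rate ::
    "(real \<Rightarrow> real \<Rightarrow> real) \<Rightarrow> (real \<Rightarrow> real \<Rightarrow> real) \<Rightarrow> real \<Rightarrow> (real \<Rightarrow> real) \<Rightarrow> real \<Rightarrow> real" where
  "conf_rate \<kappa>0 \<kappa>1 \<alpha> p t = (p t - \<kappa>1 \<alpha> t) / \<kappa>0 \<alpha> t"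

text \<open>
  Complex-valued because of the principal logarithm; the values are real when \<open>q\<close> is
  rd-continuous, since \<open>1 + \<mu> q < 0\<close> then holds at only finitely many points of a bounded
  interval and each of them contributes \<open>\<i>\<pi>\<close> to the integral.
\<close>

definition conf_exp ::
    "real set \<Rightarrow> (real \<Rightarrow> real \<Rightarrow> real) \<Rightarrow> (real \<Rightarrow> real \<Rightarrow> real) \<Rightarrow> real \<Rightarrow> (real \<Rightarrow> real)
      \<Rightarrow> real \<Rightarrow> real \<Rightarrow> complex" where
  "conf_exp T \<kappa>0 \<kappa>1 \<alpha> p t s = ts_exp T (conf_rate \<kappa>0 \<kappa>1 \<alpha> p) t s"

definition conf_cosh ::
    "real set \<Rightarrow> (real \<Rightarrow> real \<Rightarrow> real) \<Rightarrow> (real \<Rightarrow> real \<Rightarrow> real) \<Rightarrow> real \<Rightarrow> real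
      \<Rightarrow> real \<Rightarrow> real \<Rightarrow> complex" where
  "conf_cosh T \<kappa>0 \<kappa>1 \<alpha> \<gamma> t s =
     (conf_exp T \<kappa>0 \<kappa>1 \<alpha> (\<lambda>_. \<gamma>) t s + conf_exp T \<kappa>0 \<kappa>1 \<alpha> (\<lambda>_. - \<gamma>) t s) / 2"

definition conf_sinh ::
    "real set \<Rightarrow> (real \<Rightarrow> real \<Rightarrow> real) \<Rightarrow> (real \<Rightarrow> real \<Rightarrow> real) \<Rightarrow> real \<Rightarrow> real
      \<Rightarrow> real \<Rightarrow> real \<Rightarrow> complex" where
  "conf_sinh T \<kappa>0 \<kappa>1 \<alpha> \<gamma> t s =
     (conf_exp T \<kappa>0 \<kappa>1 \<alpha> (\<lambda>_. \<gamma>) t s - conf_exp T \<kappa>0 \<kappa>1 \<alpha> (\<lambda>_. - \<gamma>) t s) / 2"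

definition has_conf_derivative ::
    "real set \<Rightarrow> (real \<Rightarrow> real \<Rightarrow> real) \<Rightarrow> (real \<Rightarrow> real \<Rightarrow> real) \<Rightarrow> real
      \<Rightarrow> (real \<Rightarrow> real) \<Rightarrow> real \<Rightarrow> real \<Rightarrow> bool" where
  "has_conf_derivative T \<kappa>0 \<kappa>1 \<alpha> f v t \<longleftrightarrow>
     (\<exists>d. has_delta_derivative T f d t \<and> v = \<kappa>1 \<alpha> t * f t + \<kappa>0 \<alpha> t * d)"

text \<open>
  \<open>y\<close> is regarded as a function on \<open>T \<inter> [t\<^sub>0, \<infinity>)\<close> only, so delta derivatives are taken on that
  time scale (one-sided at \<open>t\<^sub>0\<close>, even if \<open>t\<^sub>0\<close> is left-dense in \<open>T\<close>). The first conformable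
  derivative \<open>u\<close> is a function on \<open>T\<^sup>\<kappa> \<inter> [t\<^sub>0, \<infinity>)\<close>, and is differentiated on that time scale.
\<close>

definition conf_solution ::
    "real set \<Rightarrow> (real \<Rightarrow> real \<Rightarrow> real) \<Rightarrow> (real \<Rightarrow> real \<Rightarrow> real) \<Rightarrow> real \<Rightarrow> real \<Rightarrow> real
      \<Rightarrow> (real \<Rightarrow> real) \<Rightarrow> bool" where
  "conf_solution T \<kappa>0 \<kappa>1 \<alpha> \<gamma> t0 y \<longleftrightarrow>
     (\<exists>u v.
        (\<forall>t \<in> ts_kappa T \<inter> {t0..}.
           has_conf_derivative (T \<inter> {t0..}) \<kappa>0 \<kappa>1 \<alpha> y (u t) t) \<and>
        (\<forall>t \<in> ts_kappa (ts_kappa T) \<inter> {t0..}.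
           has_conf_derivative (ts_kappa T \<inter> {t0..}) \<kappa>0 \<kappa>1 \<alpha> u (v t) t \<and>
           v t - \<gamma>\<^sup>2 * y t = 0))"

end

theory Submission
  imports Defs
begin

text \<open>
  Put \<open>q\<^sub>c = (c - \<kappa>\<^sub>1) / \<kappa>\<^sub>0\<close>. Since \<open>\<kappa>\<^sub>0\<close> does not vanish, \<open>\<Delta>\<^sup>\<alpha> z = c z\<close> is the first-order
  linear dynamic equation \<open>z\<^sup>\<Delta> = q\<^sub>c z\<close>, and \<open>\<Delta>\<^sup>\<alpha> \<Delta>\<^sup>\<alpha> - \<gamma>\<^sup>2\<close> factors as
  \<open>(\<Delta>\<^sup>\<alpha> - \<gamma>) (\<Delta>\<^sup>\<alpha> + \<gamma>)\<close>. The exponentials \<open>E\<^sub>\<gamma>\<close> and \<open>E\<^sub>-\<^sub>\<gamma>\<close> are eigenfunctions of \<open>\<Delta>\<^sup>\<alpha>\<close>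
  for \<open>\<gamma>\<close> and \<open>-\<gamma>\<close>, so their combinations solve the equation. Conversely, if \<open>y\<close> is a
  solution and \<open>u = \<Delta>\<^sup>\<alpha> y\<close>, then \<open>u + \<gamma> y\<close> and \<open>u - \<gamma> y\<close> are eigenfunctions for \<open>\<gamma>\<close> and \<open>-\<gamma>\<close>.
  Solutions of a first-order equation are multiples of its exponential, and \<open>y\<close> is the
  difference of the two eigenfunctions divided by \<open>2 \<gamma>\<close>.

  Three facts about first-order equations carry this argument. An rd-continuous function
  that is also continuous at a left-dense maximum has a delta antiderivative
  (\<open>delta_antiderivative_exists\<close>): extend it to the real line as a function that is constant
  across the gaps of the time scale, and integrate. A function with zero delta derivative is
  constant (\<open>delta_derivative_zero_imp_constant\<close>), which makes the delta integral well
  defined. The quotient of two solutions of the same linear equation has zero derivative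
  (\<open>delta_linear_unique\<close>). The last fact also shows that the exponential is real although it
  is defined by a complex logarithm: it solves the same initial value problem as its complex
  conjugate.

  The delicate point is the end of the time scale. Let \<open>T\<close> have a left-scattered maximum
  \<open>M\<close> with \<open>m = \<rho>(M)\<close> left-dense. Then \<open>u\<close> lives on \<open>T\<^sup>\<kappa>\<close>, whose maximum is \<open>m\<close>, and its derivative
  at \<open>m\<close> is the limit of slopes from the left, whereas the derivative of \<open>y\<close> at \<open>m\<close> is the
  slope of the step from \<open>m\<close> to \<open>M\<close>. In one direction the exponential has to
  satisfy its equation for both notions of derivative. It does because the exponentials
  formed on \<open>T\<close> and on \<open>T\<^sup>\<kappa>\<close> agree on \<open>T\<^sup>\<kappa>\<close> (\<open>ts_exp_forward\<close>). In the other direction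
  uniqueness is applied on \<open>T\<^sup>\<kappa>\<close>, using derivatives only before the endpoint and continuity
  at it, and the value of \<open>y\<close> at \<open>M\<close> follows by one explicit step
  (\<open>conf_solution_is_exp_combination\<close>).
\<close>

section \<open>Jumps and induction on a time scale\<close>

lemma fwd_jump_max:
  assumes "t \<in> T" "\<And>s. s \<in> T \<Longrightarrow> s \<le> t"
  shows "fwd_jump T t = t"
proof -
  have "Sup T = t" using assms by (intro cSup_eq_maximum) auto
  then show ?thesis using assms(2) by (force simp: fwd_jump_def)
qed

lemma fwd_jump_in:
  assumes "closed T" "t \<in> T"
  shows "fwd_jump T t \<in> T" "t \<le> fwd_jump T t"
proof -
  have "fwd_jump T t \<in> T \<and> t \<le> fwd_jump T t"
  proof (cases "{s \<in> T. t < s} = {}")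
    case True
    then have "fwd_jump T t = t" using assms(2) by (intro fwd_jump_max) (auto simp: not_less)
    with assms(2) show ?thesis by simp
  next
    case False
    have bb: "bdd_below {s \<in> T. t < s}" by (auto simp: bdd_below_def intro: less_imp_le)
    have "Inf {s \<in> T. t < s} \<in> closure {s \<in> T. t < s}"
      by (rule closure_contains_Inf[OF False bb])
    moreover have "closure {s \<in> T. t < s} \<subseteq> T"
      using assms(1) by (intro closure_minimal) auto
    moreover have "t \<le> Inf {s \<in> T. t < s}" by (rule cInf_greatest[OF False]) auto
    ultimately show ?thesis unfolding fwd_jump_def using False by auto
  qed
  then show "fwd_jump T t \<in> T" "t \<le> fwd_jump T t" by auto
qed

lemma fwd_jump_le:
  assumes "s \<in> T" "t < s"
  shows "fwd_jump T t \<le> s"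
proof -
  have "bdd_below {s \<in> T. t < s}" by (auto simp: bdd_below_def intro: less_imp_le)
  then show ?thesis unfolding fwd_jump_def using assms by (auto intro!: cInf_lower)
qed

lemma fwd_jump_eqI:
  assumes "s \<in> T" "t < s" "\<And>r. r \<in> T \<Longrightarrow> t < r \<Longrightarrow> s \<le> r"
  shows "fwd_jump T t = s"
proof -
  have "Inf {s \<in> T. t < s} = s" using assms by (intro cInf_eq_minimum) auto
  then show ?thesis using assms by (auto simp: fwd_jump_def)
qed

lemma right_dense_approx:
  assumes "r \<in> T" "t < r" "fwd_jump T t = t" "0 < \<delta>"
  obtains s where "s \<in> T" "t < s" "s < t + \<delta>"
proof -
  have "{s \<in> T. t < s} \<noteq> {}" using assms by auto
  moreover have "Inf {s \<in> T. t < s} < t + \<delta>" using assms by (auto simp: fwd_jump_def split: if_splits)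
  ultimately have "\<exists>s\<in>{s \<in> T. t < s}. s < t + \<delta>" by (rule cInf_lessD)
  then show ?thesis using that by blast
qed

text \<open>
  If the property failed somewhere, let \<open>c\<close> be the infimum of the points of failure. If it
  holds at \<open>c\<close>, a step to the right of \<open>c\<close> contradicts the choice of \<open>c\<close>. If it
  fails at \<open>c\<close>, then it is reached from the left, by a jump or as a limit.
\<close>
lemma time_scale_induct [consumes 4, case_names base step dense limit]:
  assumes "closed T" "a \<in> T" "b \<in> T" "a \<le> b"
    and base: "P a"
    and step: "\<And>t. t \<in> T \<Longrightarrow> a \<le> t \<Longrightarrow> t < b \<Longrightarrow> P t \<Longrightarrow> t < fwd_jump T t \<Longrightarrow> P (fwd_jump T t)"
    and dense: "\<And>t. t \<in> T \<Longrightarrow> a \<le> t \<Longrightarrow> t < b \<Longrightarrow> P t \<Longrightarrow> fwd_jump T t = t \<Longrightarrow>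
                  \<exists>\<delta>>0. \<forall>s\<in>T. t < s \<longrightarrow> s < t + \<delta> \<longrightarrow> P s"
    and limit: "\<And>t. t \<in> T \<Longrightarrow> a < t \<Longrightarrow> t \<le> b \<Longrightarrow> t islimpt (T \<inter> {a..<t}) \<Longrightarrow>
                  (\<And>s. s \<in> T \<Longrightarrow> a \<le> s \<Longrightarrow> s < t \<Longrightarrow> P s) \<Longrightarrow> P t"
  shows "P b"
proof (rule ccontr)
  assume "\<not> P b"
  define B where "B = {s \<in> T. a \<le> s \<and> s \<le> b \<and> \<not> P s}"
  define c where "c = Inf B"
  have bB: "b \<in> B" using assms \<open>\<not> P b\<close> by (auto simp: B_def)
  have bdd: "bdd_below B" by (auto simp: B_def bdd_below_def)
  have "c \<in> closure B" unfolding c_def using bB bdd by (intro closure_contains_Inf) auto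
  moreover have "closure B \<subseteq> T \<inter> {a..b}"
    using assms(1) by (intro closure_minimal) (auto simp: B_def)
  ultimately have cT: "c \<in> T" "a \<le> c" "c \<le> b" by auto
  have below: "P s" if "s \<in> T" "a \<le> s" "s < c" for s
  proof (rule ccontr)
    assume "\<not> P s"
    with that cT have "s \<in> B" by (auto simp: B_def)
    then have "c \<le> s" unfolding c_def using bdd by (rule cInf_lower)
    with that show False by simp
  qed
  show False
  proof (cases "P c")
    case True
    with \<open>\<not> P b\<close> cT have "c < b" by (cases "c = b") auto
    show False
    proof (cases "c < fwd_jump T c")
      case True
      have "s = fwd_jump T c \<or> fwd_jump T c < s" if "s \<in> B" for s
      proof -
        have "c \<le> s" unfolding c_def using bdd that by (intro cInf_lower)
        moreover have "c \<noteq> s" using \<open>P c\<close> that by (auto simp: B_def)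
        ultimately have "fwd_jump T c \<le> s" using that by (intro fwd_jump_le) (auto simp: B_def)
        then show ?thesis by auto
      qed
      then have "fwd_jump T c \<le> Inf B" using bB by (intro cInf_greatest) force+
      with True show False by (simp add: c_def[symmetric])
    next
      case False
      with fwd_jump_in[OF assms(1) cT(1)] have "fwd_jump T c = c" by simp
      then obtain \<delta> where \<delta>: "\<delta> > 0" "\<And>s. s \<in> T \<Longrightarrow> c < s \<Longrightarrow> s < c + \<delta> \<Longrightarrow> P s"
        using dense[OF cT(1,2) \<open>c < b\<close> \<open>P c\<close>] by blast
      have "Inf B < c + \<delta>" using \<delta>(1) by (simp add: c_def)
      then obtain s where s: "s \<in> B" "s < c + \<delta>" using bB cInf_lessD[of B] by blast
      have "c \<le> s" unfolding c_def using bdd s by (intro cInf_lower)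
      moreover have "c \<noteq> s" using \<open>P c\<close> s by (auto simp: B_def)
      ultimately have "P s" using \<delta>(2)[of s] s by (auto simp: B_def)
      with s show False by (simp add: B_def)
    qed
  next
    case False
    with base cT have "a < c" by (cases "a = c") auto
    show False
    proof (cases "c islimpt (T \<inter> {a..<c})")
      case True
      with False below limit[OF cT(1) \<open>a < c\<close> cT(3)] show False by blast
    next
      case notlim: False
      define p where "p = Sup (T \<inter> {a..<c})"
      have ne: "T \<inter> {a..<c} \<noteq> {}" using assms \<open>a < c\<close> by auto
      have bda: "bdd_above (T \<inter> {a..<c})" by (rule bdd_aboveI[of _ c]) auto
      have pcl: "p \<in> closure (T \<inter> {a..<c})"
        unfolding p_def by (rule closure_contains_Sup[OF ne bda])
      moreover have "closure (T \<inter> {a..<c}) \<subseteq> T \<inter> {a..c}"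
        using assms(1) by (intro closure_minimal) auto
      ultimately have p: "p \<in> T" "a \<le> p" "p \<le> c" by auto
      have "p \<noteq> c" using pcl notlim by (auto simp: closure_def)
      with p have "p < c" by simp
      have "fwd_jump T p = c"
      proof (rule fwd_jump_eqI[OF cT(1) \<open>p < c\<close>])
        fix r assume r: "r \<in> T" "p < r"
        show "c \<le> r"
        proof (rule ccontr)
          assume "\<not> c \<le> r"
          then have "r \<le> p" unfolding p_def using r p bda by (intro cSup_upper) auto
          with r show False by simp
        qed
      qed
      then have "P c" using step[OF p(1,2)] below[OF p(1,2) \<open>p < c\<close>] \<open>p < c\<close> cT by simp
      with False show False by simp
    qed
  qed
qed

section \<open>Delta derivatives\<close>

text \<open>
  At a point that is not right-scattered the delta derivative is the ordinary derivative
  within the time scale, and at a right-scattered point it is a difference quotient together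
  with continuity. After these two characterisations the calculus rules come from the
  ordinary ones, case by case.
\<close>
lemma has_delta_derivative_altdef:
  "has_delta_derivative T f d t \<longleftrightarrow>
     (\<forall>\<epsilon>>0. \<exists>\<delta>>0. \<forall>s\<in>T. \<bar>s - t\<bar> < \<delta> \<longrightarrow>
        norm (f (fwd_jump T t) - f s - (fwd_jump T t - s) *\<^sub>R d) \<le> \<epsilon> * \<bar>fwd_jump T t - s\<bar>)"
proof -
  have "(\<forall>s\<in>{t - \<delta> <..< t + \<delta>} \<inter> T. P s) \<longleftrightarrow> (\<forall>s\<in>T. \<bar>s - t\<bar> < \<delta> \<longrightarrow> P s)" for \<delta> P
    by (auto simp: abs_less_iff)
  then show ?thesis unfolding has_delta_derivative_def by simp
qed

lemma has_delta_derivative_dense: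
  assumes "fwd_jump T t = t"
  shows "has_delta_derivative T f d t \<longleftrightarrow> (f has_vector_derivative d) (at t within T)"
proof -
  have "norm (f t - f s - (t - s) *\<^sub>R d) = norm (f s - f t - (s - t) *\<^sub>R d)" for s
  proof -
    have "f t - f s - (t - s) *\<^sub>R d = - (f s - f t - (s - t) *\<^sub>R d)"
      by (simp add: algebra_simps)
    then show ?thesis by (metis norm_minus_cancel)
  qed
  then show ?thesis
    unfolding has_delta_derivative_altdef has_vector_derivative_def has_derivative_within_alt assms
    by (simp add: bounded_linear_scaleR_left abs_minus_commute)
qed

lemma has_delta_derivative_scattered:
  assumes "t \<in> T" "t < fwd_jump T t"
  shows "has_delta_derivative T f d t \<longleftrightarrow>
     continuous (at t within T) f \<and> f (fwd_jump T t) = f t + graininess T t *\<^sub>R d"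
proof -
  define m where "m = graininess T t"
  define g where "g s = f (fwd_jump T t) - f s - (fwd_jump T t - s) *\<^sub>R d" for s
  have m: "m > 0" "fwd_jump T t = t + m" using assms by (auto simp: m_def graininess_def)
  have def1: "has_delta_derivative T f d t \<longleftrightarrow>
     (\<forall>\<epsilon>>0. \<exists>\<delta>>0. \<forall>s\<in>T. \<bar>s - t\<bar> < \<delta> \<longrightarrow> norm (g s) \<le> \<epsilon> * \<bar>t + m - s\<bar>)"
    unfolding has_delta_derivative_altdef g_def m(2) ..
  have gt: "g t = f (fwd_jump T t) - f t - m *\<^sub>R d" by (simp add: g_def m(2))
  have cont: "continuous (at t within T) f \<longleftrightarrow> continuous (at t within T) g"
  proof
    assume "continuous (at t within T) f"
    then show "continuous (at t within T) g" unfolding g_def by (intro continuous_intros)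
  next
    assume "continuous (at t within T) g"
    then have "continuous (at t within T) (\<lambda>s. f (fwd_jump T t) - g s - (fwd_jump T t - s) *\<^sub>R d)"
      by (intro continuous_intros)
    then show "continuous (at t within T) f" by (simp add: g_def)
  qed
  have "has_delta_derivative T f d t \<longleftrightarrow> continuous (at t within T) g \<and> g t = 0"
  proof
    assume D: "has_delta_derivative T f d t"
    (* The point s = t itself is among the tested points, so the error there is 0. *)
    have "norm (g t) \<le> e" if "e > 0" for e
    proof -
      obtain \<delta> where "\<delta> > 0" "\<forall>s\<in>T. \<bar>s - t\<bar> < \<delta> \<longrightarrow> norm (g s) \<le> (e / m) * \<bar>t + m - s\<bar>"
        using D[unfolded def1, rule_format, of "e / m"] m \<open>e > 0\<close> by auto
      then show ?thesis using assms m by force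
    qed
    then have g0: "g t = 0"
      by (metis field_le_epsilon add.left_neutral norm_le_zero_iff)
    have "\<exists>\<delta>>0. \<forall>s\<in>T. dist s t < \<delta> \<longrightarrow> dist (g s) (g t) < e" if "e > 0" for e
    proof -
      obtain \<delta> where \<delta>: "\<delta> > 0" "\<And>s. s\<in>T \<Longrightarrow> \<bar>s - t\<bar> < \<delta> \<Longrightarrow> norm (g s) \<le> (e / (3 * m)) * \<bar>t + m - s\<bar>"
        (* 3 m exceeds the distance from s to the jump, at most 2 m when s is within m of t. *)
        using D[unfolded def1, rule_format, of "e / (3 * m)"] m \<open>e > 0\<close> by auto
      have "norm (g s) < e" if s: "s \<in> T" "\<bar>s - t\<bar> < min \<delta> m" for s
      proof -
        have "norm (g s) \<le> (e / (3 * m)) * \<bar>t + m - s\<bar>" using \<delta>(2) s by auto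
        also have "\<dots> \<le> (e / (3 * m)) * (2 * m)"
          using s m \<open>e > 0\<close> by (intro mult_left_mono) auto
        also have "\<dots> < e" using m \<open>e > 0\<close> by simp
        finally show ?thesis .
      qed
      then show ?thesis using \<delta>(1) m g0 by (intro exI[of _ "min \<delta> m"]) (auto simp: dist_norm)
    qed
    with g0 show "continuous (at t within T) g \<and> g t = 0"
      by (auto simp: continuous_within_eps_delta)
  next
    assume *: "continuous (at t within T) g \<and> g t = 0"
    show "has_delta_derivative T f d t" unfolding def1
    proof (intro allI impI)
      fix \<epsilon> :: real assume "\<epsilon> > 0"
      then have "\<epsilon> * (m / 2) > 0" using m by simp
      then obtain \<delta> where \<delta>: "\<delta> > 0" "\<And>s. s\<in>T \<Longrightarrow> \<bar>s - t\<bar> < \<delta> \<Longrightarrow> norm (g s) < \<epsilon> * (m / 2)"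
        using conjunct1[OF *, unfolded continuous_within_eps_delta, rule_format, of "\<epsilon> * (m / 2)"] conjunct2[OF *]
        by (simp add: dist_norm) blast
      have "norm (g s) \<le> \<epsilon> * \<bar>t + m - s\<bar>" if "s \<in> T" "\<bar>s - t\<bar> < min \<delta> (m / 2)" for s
      proof -
        have "norm (g s) \<le> \<epsilon> * (m / 2)" using \<delta>(2) that by force
        also have "\<dots> \<le> \<epsilon> * \<bar>t + m - s\<bar>" using that \<open>\<epsilon> > 0\<close> by (intro mult_left_mono) (auto simp: abs_if split: if_splits)
        finally show ?thesis .
      qed
      then show "\<exists>\<delta>>0. \<forall>s\<in>T. \<bar>s - t\<bar> < \<delta> \<longrightarrow> norm (g s) \<le> \<epsilon> * \<bar>t + m - s\<bar>"
        using \<delta>(1) m by (intro exI[of _ "min \<delta> (m / 2)"]) auto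
    qed
  qed
  also have "\<dots> \<longleftrightarrow> continuous (at t within T) f \<and> f (fwd_jump T t) = f t + graininess T t *\<^sub>R d"
    unfolding cont[symmetric] gt m_def by (auto simp: algebra_simps)
  finally show ?thesis .
qed

lemma has_delta_derivative_continuous:
  assumes "closed T" "t \<in> T" "has_delta_derivative T f d t"
  shows "continuous (at t within T) f"
proof (cases "fwd_jump T t = t")
  case True
  then show ?thesis using assms(3) by (auto simp: has_delta_derivative_dense intro: has_vector_derivative_continuous)
next
  case False
  with fwd_jump_in[OF assms(1,2)] have "t < fwd_jump T t" by simp
  with assms show ?thesis by (simp add: has_delta_derivative_scattered)
qed

lemma has_delta_derivative_jump:
  assumes "closed T" "t \<in> T" "has_delta_derivative T f d t"
  shows "f (fwd_jump T t) = f t + graininess T t *\<^sub>R d"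
proof (cases "fwd_jump T t = t")
  case True
  then show ?thesis by (simp add: graininess_def)
next
  case False
  with fwd_jump_in[OF assms(1,2)] have "t < fwd_jump T t" by simp
  with assms show ?thesis by (simp add: has_delta_derivative_scattered)
qed

lemma has_delta_derivativeI:
  assumes "closed T" "t \<in> T"
    and "fwd_jump T t = t \<Longrightarrow> (f has_vector_derivative d) (at t within T)"
    and "t < fwd_jump T t \<Longrightarrow> continuous (at t within T) f"
    and "t < fwd_jump T t \<Longrightarrow> f (fwd_jump T t) = f t + graininess T t *\<^sub>R d"
  shows "has_delta_derivative T f d t"
  using fwd_jump_in(2)[OF assms(1,2)] assms(2-)
  by (cases "fwd_jump T t = t") (auto simp: has_delta_derivative_dense has_delta_derivative_scattered)

lemma has_delta_derivative_subset:
  assumes "has_delta_derivative T f d t" "X \<subseteq> T" "fwd_jump X t = fwd_jump T t"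
  shows "has_delta_derivative X f d t"
  using assms unfolding has_delta_derivative_altdef by (simp add: subset_iff) meson

lemma has_delta_derivative_cong:
  assumes "closed T" "t \<in> T" "\<And>s. s \<in> T \<Longrightarrow> f s = g s"
  shows "has_delta_derivative T f d t = has_delta_derivative T g d t"
  using assms(3) fwd_jump_in[OF assms(1,2)] unfolding has_delta_derivative_altdef by simp

lemma has_delta_derivative_linear:
  assumes "bounded_linear h" "closed T" "t \<in> T" "has_delta_derivative T f d t"
  shows "has_delta_derivative T (\<lambda>s. h (f s)) (h d) t"
proof (rule has_delta_derivativeI[OF assms(2,3)])
  interpret h: bounded_linear h by fact
  { assume "fwd_jump T t = t"
    then show "((\<lambda>s. h (f s)) has_vector_derivative h d) (at t within T)"
      using assms by (auto simp: has_delta_derivative_dense intro: h.has_vector_derivative) }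
  show "continuous (at t within T) (\<lambda>s. h (f s))"
    using has_delta_derivative_continuous[OF assms(2-)] by (rule h.continuous)
  show "h (f (fwd_jump T t)) = h (f t) + graininess T t *\<^sub>R h d"
    using has_delta_derivative_jump[OF assms(2-)] by (simp add: h.add h.scaleR)
qed

lemma has_delta_derivative_add:
  assumes "closed T" "t \<in> T" "has_delta_derivative T f d t" "has_delta_derivative T g d' t"
  shows "has_delta_derivative T (\<lambda>s. f s + g s) (d + d') t"
proof (rule has_delta_derivativeI[OF assms(1,2)])
  { assume "fwd_jump T t = t"
    then show "((\<lambda>s. f s + g s) has_vector_derivative (d + d')) (at t within T)"
      using assms by (auto simp: has_delta_derivative_dense intro: has_vector_derivative_add) }
  show "continuous (at t within T) (\<lambda>s. f s + g s)"
    using has_delta_derivative_continuous[OF assms(1,2)] assms by (intro continuous_intros) auto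
  show "f (fwd_jump T t) + g (fwd_jump T t) = f t + g t + graininess T t *\<^sub>R (d + d')"
    using has_delta_derivative_jump[OF assms(1-3)] has_delta_derivative_jump[OF assms(1,2,4)]
    by (simp add: algebra_simps)
qed

section \<open>Uniqueness for first-order linear equations\<close>

text \<open>
  By induction, the increment of \<open>G\<close> is at most \<open>e * (b - a)\<close> for every \<open>e > 0\<close>: jumps add
  nothing, dense points add the allowed error, and limits preserve the bound. Only continuity
  is asked for at \<open>b\<close>, so that the lemma applies to functions on \<open>T\<close> up to an end point at
  which nothing is known about their derivative.
\<close>
lemma delta_derivative_zero_imp_constant:
  fixes G :: "real \<Rightarrow> 'a::real_normed_vector"
  assumes "closed T" "a \<in> T" "b \<in> T" "a \<le> b"
    and D: "\<And>t. t \<in> T \<Longrightarrow> a \<le> t \<Longrightarrow> t < b \<Longrightarrow> has_delta_derivative T G 0 t"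
    and C: "continuous (at b within T) G"
  shows "G b = G a"
proof -
  have "norm (G b - G a) \<le> e * (b - a)" if "e > 0" for e
    using assms(1-4)
  proof (induction rule: time_scale_induct)
    case base
    show ?case by simp
  next
    case (step t)
    have "G (fwd_jump T t) = G t"
      using has_delta_derivative_jump[OF assms(1) step(1) D[OF step(1-3)]] by simp
    moreover have "e * (t - a) \<le> e * (fwd_jump T t - a)"
      using step(4) \<open>e > 0\<close> by (intro mult_left_mono) auto
    ultimately show ?case using step(5) by simp
  next
    case (dense t)
    obtain \<delta> where \<delta>: "\<delta> > 0" "\<forall>s \<in> {t - \<delta> <..< t + \<delta>} \<inter> T. norm (G t - G s) \<le> e * \<bar>t - s\<bar>"
      using D[OF dense(1-3)] \<open>e > 0\<close> dense(4) unfolding has_delta_derivative_def by auto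
    have "norm (G s - G a) \<le> e * (s - a)" if s: "s \<in> T" "t < s" "s < t + \<delta>" for s
    proof -
      have "norm (G t - G s) \<le> e * (s - t)" using \<delta> s by force
      moreover have "norm (G s - G a) \<le> norm (G t - G s) + norm (G t - G a)"
        using norm_triangle_ineq4[of "G t - G a" "G t - G s"] by simp
      ultimately show ?thesis using dense(5) by (simp add: algebra_simps)
    qed
    with \<delta>(1) show ?case by blast
  next
    case (limit t)
    have ct: "continuous (at t within T) G"
      using C has_delta_derivative_continuous[OF assms(1) limit(1) D[OF limit(1)]] limit(2,3)
      by (cases "t = b") auto
    let ?F = "at t within (T \<inter> {a..<t})"
    have nb: "?F \<noteq> bot" using limit(4) by (simp add: trivial_limit_within)
    have "(G \<longlongrightarrow> G t) ?F" using ct unfolding continuous_within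
      by (rule tendsto_within_subset) auto
    then have 1: "((\<lambda>s. norm (G s - G a)) \<longlongrightarrow> norm (G t - G a)) ?F" by (intro tendsto_intros)
    have 2: "((\<lambda>s. e * (s - a)) \<longlongrightarrow> e * (t - a)) ?F" by (intro tendsto_intros)
    show ?case
      by (rule tendsto_le[OF nb 2 1]) (use limit(5) in \<open>auto simp: eventually_at_filter\<close>)
  qed
  then have le: "norm (G b - G a) \<le> e * (b - a)" if "e > 0" for e using that by blast
  have "norm (G b - G a) \<le> 0 + e" if "e > 0" for e
  proof -
    have "norm (G b - G a) \<le> e / (b - a + 1) * (b - a)" using assms(4) that by (intro le) auto
    also have "\<dots> \<le> e" using assms(4) that by (simp add: field_simps)
    finally show ?thesis by simp
  qed
  then have "norm (G b - G a) \<le> 0" by (rule field_le_epsilon)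
  then show ?thesis by simp
qed

text \<open>
  The quotient has zero derivative. At a jump, numerator and denominator are both multiplied
  by \<open>1 + \<mu> q\<close>, which does not vanish because \<open>E\<close> does not vanish after the jump.
\<close>
lemma delta_linear_unique:
  fixes w E :: "real \<Rightarrow> 'a::real_normed_field"
  assumes "closed T" "a \<in> T" "b \<in> T" "a \<le> b"
    and w: "\<And>t. t \<in> T \<Longrightarrow> a \<le> t \<Longrightarrow> t < b \<Longrightarrow> has_delta_derivative T w (q t *\<^sub>R w t) t"
    and E: "\<And>t. t \<in> T \<Longrightarrow> a \<le> t \<Longrightarrow> t < b \<Longrightarrow> has_delta_derivative T E (q t *\<^sub>R E t) t"
    and nz: "\<And>t. t \<in> T \<Longrightarrow> a \<le> t \<Longrightarrow> t \<le> b \<Longrightarrow> E t \<noteq> 0"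
    and "continuous (at b within T) w" "continuous (at b within T) E"
  shows "w b / E b = w a / E a"
proof (rule delta_derivative_zero_imp_constant[where T = T])
  show "continuous (at b within T) (\<lambda>t. w t / E t)"
    using assms(8,9) nz[of b] assms(3,4) unfolding continuous_within by (intro tendsto_divide) auto
next
  fix t assume t: "t \<in> T" "a \<le> t" "t < b"
  note wt = w[OF t] and Et = E[OF t]
  have Ent: "E t \<noteq> 0" using nz t by auto
  show "has_delta_derivative T (\<lambda>t. w t / E t) 0 t"
  proof (rule has_delta_derivativeI[OF assms(1) t(1)])
    assume "fwd_jump T t = t"
    then have "(w has_derivative (\<lambda>h. h *\<^sub>R (q t *\<^sub>R w t))) (at t within T)"
              "(E has_derivative (\<lambda>h. h *\<^sub>R (q t *\<^sub>R E t))) (at t within T)"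
      using wt Et by (auto simp: has_delta_derivative_dense has_vector_derivative_def)
    from has_derivative_divide'[OF this Ent]
    show "((\<lambda>t. w t / E t) has_vector_derivative 0) (at t within T)"
      unfolding has_vector_derivative_def by (simp add: mult.commute)
  next
    show "continuous (at t within T) (\<lambda>t. w t / E t)"
      using has_delta_derivative_continuous[OF assms(1) t(1) wt]
        has_delta_derivative_continuous[OF assms(1) t(1) Et] Ent
      unfolding continuous_within by (intro tendsto_divide) auto
  next
    let ?c = "of_real (1 + graininess T t * q t) :: 'a"
    have ws: "w (fwd_jump T t) = ?c * w t"
      using has_delta_derivative_jump[OF assms(1) t(1) wt] by (simp add: scaleR_conv_of_real algebra_simps)
    have Es: "E (fwd_jump T t) = ?c * E t"
      using has_delta_derivative_jump[OF assms(1) t(1) Et] by (simp add: scaleR_conv_of_real algebra_simps)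
    have "E (fwd_jump T t) \<noteq> 0"
      using t assms fwd_jump_in[OF assms(1) t(1)] by (intro nz fwd_jump_le) auto
    then have "?c \<noteq> 0" using Es by auto
    then show "w (fwd_jump T t) / E (fwd_jump T t) = w t / E t + graininess T t *\<^sub>R 0"
      unfolding ws Es by simp
  qed
qed (use assms in auto)

section \<open>Antiderivatives\<close>

text \<open>
  Composition with this map extends a function on \<open>T\<close> to one that is constant on each gap
  \<open>[t, \<sigma>(t))\<close>, so that its integral over the gap is \<open>\<mu>(t) f(t)\<close>, as required of a delta
  integral. Left of \<open>T\<close> the value is the supremum of the empty set, an unspecified constant,
  which keeps the extension locally constant there too.
\<close>
definition ts_floor :: "real set \<Rightarrow> real \<Rightarrow> real" where
  "ts_floor T x = Sup (T \<inter> {..x})"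

lemma ts_floor_in:
  assumes "closed T" "s \<in> T" "s \<le> x"
  shows "ts_floor T x \<in> T" "s \<le> ts_floor T x" "ts_floor T x \<le> x"
proof -
  have ne: "T \<inter> {..x} \<noteq> {}" and bdd: "bdd_above (T \<inter> {..x})"
    using assms by (auto simp: bdd_above_def)
  have "Sup (T \<inter> {..x}) \<in> T \<inter> {..x}"
    using assms(1) by (intro closed_contains_Sup[OF ne bdd]) auto
  then show "ts_floor T x \<in> T" "ts_floor T x \<le> x" by (auto simp: ts_floor_def)
  show "s \<le> ts_floor T x" unfolding ts_floor_def using assms bdd by (intro cSup_upper) auto
qed

lemma ts_floor_cong:
  assumes "\<And>s. s \<in> T \<Longrightarrow> s \<le> x \<longleftrightarrow> s \<le> y"
  shows "ts_floor T x = ts_floor T y"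
  unfolding ts_floor_def using assms by (intro arg_cong[where f = Sup]) auto

lemma ts_floor_between_jump:
  assumes "closed T" "t \<in> T" "t \<le> x" "x < fwd_jump T t"
  shows "ts_floor T x = t"
proof -
  have "s \<le> t" if "s \<in> T" "s \<le> x" for s using fwd_jump_le[of s T t] that assms by force
  then show ?thesis using ts_floor_in[OF assms(1-3)] by (metis order_antisym)
qed

text \<open>
  Near each point such a function is uniformly close to a step function with one break, and
  by bisection these local approximations patch together over the whole interval.
\<close>
lemma regulated_integrable:
  fixes g :: "real \<Rightarrow> 'a::banach"
  assumes left: "\<And>x. \<exists>l. (g \<longlongrightarrow> l) (at_left x)" and right: "\<And>x. \<exists>r. (g \<longlongrightarrow> r) (at_right x)"
  shows "g integrable_on {a..b}"
proof (cases "a \<le> b")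
  case True
  have "\<exists>h. (\<forall>x\<in>{a..b}. norm (g x - h x) \<le> e) \<and> h integrable_on {a..b}" if "e > 0" for e
    using True
  proof (induction rule: Bolzano)
    case (trans a b c)
    then obtain h k where
      h: "\<And>x. x\<in>{a..b} \<Longrightarrow> norm (g x - h x) \<le> e" "h integrable_on {a..b}" and
      k: "\<And>x. x\<in>{b..c} \<Longrightarrow> norm (g x - k x) \<le> e" "k integrable_on {b..c}" by blast
    let ?f = "\<lambda>x. if x < b then h x else k x"
    have "?f integrable_on {a..b}"
      by (rule integrable_spike_finite[of "{b}" _ _ h]) (use h in auto)
    moreover have "?f integrable_on {b..c}"
      by (rule integrable_spike_finite[of "{}" _ _ k]) (use k in auto)
    ultimately have "?f integrable_on {a..c}"
      using trans by (intro Henstock_Kurzweil_Integration.integrable_combine[where a = a and c = b and b = c]) auto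
    moreover have "\<forall>x\<in>{a..c}. norm (g x - ?f x) \<le> e" using h k by auto
    ultimately show ?case by (intro exI[of _ ?f] conjI)
  next
    case (local x)
    obtain l r where l: "(g \<longlongrightarrow> l) (at_left x)" and r: "(g \<longlongrightarrow> r) (at_right x)"
      using left right by blast
    obtain p where p: "p < x" "\<And>y. p < y \<Longrightarrow> y < x \<Longrightarrow> dist (g y) l < e"
      using tendstoD[OF l \<open>e > 0\<close>] by (auto simp: eventually_at_left_field)
    obtain q where q: "x < q" "\<And>y. x < y \<Longrightarrow> y < q \<Longrightarrow> dist (g y) r < e"
      using tendstoD[OF r \<open>e > 0\<close>] by (auto simp: eventually_at_right_field)
    let ?h = "\<lambda>y. if y < x then l else if y = x then g x else r"
    show ?case
    proof (intro exI[of _ "min (x - p) (q - x)"] conjI allI impI)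
      show "0 < min (x - p) (q - x)" using p q by simp
      fix a b assume ab: "a \<le> x \<and> x \<le> b \<and> b - a < min (x - p) (q - x)"
      have "?h integrable_on {a..x}"
        by (rule integrable_spike_finite[of "{x}" _ _ "\<lambda>_. l"]) auto
      moreover have "?h integrable_on {x..b}"
        by (rule integrable_spike_finite[of "{x}" _ _ "\<lambda>_. r"]) auto
      ultimately have "?h integrable_on {a..b}"
        using ab by (intro Henstock_Kurzweil_Integration.integrable_combine[where a = a and c = x and b = b]) auto
      moreover have "\<forall>y\<in>{a..b}. norm (g y - ?h y) \<le> e"
        using ab p q \<open>e > 0\<close> by (auto simp: dist_norm intro!: less_imp_le)
      ultimately show "\<exists>h. (\<forall>y\<in>{a..b}. norm (g y - h y) \<le> e) \<and> h integrable_on {a..b}"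
        by (intro exI[of _ ?h] conjI)
    qed
  qed
  then show ?thesis using integrable_uniform_limit[of a b g] by simp
qed auto

text \<open>
  Beside a gap the extension is locally constant. Otherwise the point belongs to \<open>T\<close> and is
  approached by points of \<open>T\<close> from that side, hence so are the floors of nearby reals, and the
  one-sided limit of \<open>f\<close> carries over.
\<close>
lemma ts_floor_regulated:
  fixes f :: "real \<Rightarrow> 'a::topological_space"
  assumes T: "closed T"
    and cont: "\<And>t. t \<in> T \<Longrightarrow> fwd_jump T t = t \<Longrightarrow> continuous (at t within T) f"
    and lim: "\<And>t. t \<in> T \<Longrightarrow> \<exists>l. (f \<longlongrightarrow> l) (at t within (T \<inter> {..<t}))"
  shows "\<exists>l. ((\<lambda>x. f (ts_floor T x)) \<longlongrightarrow> l) (at_left x)"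
    and "\<exists>r. ((\<lambda>x. f (ts_floor T x)) \<longlongrightarrow> r) (at_right x)"
proof -
  let ?g = "\<lambda>x. f (ts_floor T x)"
  show "\<exists>l. (?g \<longlongrightarrow> l) (at_left x)"
  proof (cases "\<exists>p<x. T \<inter> {p<..<x} = {}")
    case True
    then obtain p where p: "p < x" "T \<inter> {p<..<x} = {}" by blast
    then have gap: "s \<le> p \<or> x \<le> s" if "s \<in> T" for s using that by force
    obtain z where z: "p < z" "z < x" using dense p(1) by blast
    have "?g y = ?g z" if "p < y" "y < x" for y
    proof (intro arg_cong[where f = f] ts_floor_cong)
      fix s assume "s \<in> T"
      from gap[OF this] show "s \<le> y \<longleftrightarrow> s \<le> z" using z that by linarith
    qed
    then have "eventually (\<lambda>y. ?g y = ?g z) (at_left x)"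
      unfolding eventually_at_left_field using p(1) by blast
    then show ?thesis by (blast intro: tendsto_eventually)
  next
    case False
    have approx: "\<exists>s\<in>T. p < s \<and> s < x" if "p < x" for p
    proof -
      from False that have "T \<inter> {p<..<x} \<noteq> {}" by blast
      then show ?thesis by auto
    qed
    have "x islimpt T"
      unfolding islimpt_approachable_real
    proof (intro allI impI)
      fix e :: real assume "0 < e"
      then show "\<exists>x'\<in>T. x' \<noteq> x \<and> \<bar>x' - x\<bar> < e" using approx[of "x - e"] by force
    qed
    with T have "x \<in> T" by (simp add: closed_limpt)
    then obtain l where l: "(f \<longlongrightarrow> l) (at x within (T \<inter> {..<x}))" using lim by blast
    have "filterlim (ts_floor T) (at x within (T \<inter> {..<x})) (at_left x)"
      unfolding filterlim_at
    proof
      show "eventually (\<lambda>y. ts_floor T y \<in> T \<inter> {..<x} \<and> ts_floor T y \<noteq> x) (at_left x)"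
      proof -
        obtain s where s: "s \<in> T" "s < x" using approx[of "x - 1"] by auto
        have "ts_floor T y \<in> T \<inter> {..<x} \<and> ts_floor T y \<noteq> x" if "s < y" "y < x" for y
          using ts_floor_in[OF T s(1), of y] that by auto
        then show ?thesis unfolding eventually_at_left_field using s(2) by blast
      qed
      show "(ts_floor T \<longlongrightarrow> x) (at_left x)"
      proof (rule order_tendstoI)
        fix c assume "c < x"
        then obtain s where s: "s \<in> T" "c < s" "s < x" using approx by blast
        have "c < ts_floor T y" if "s < y" for y
          using ts_floor_in[OF T s(1), of y] that s(2) by simp
        then show "eventually (\<lambda>y. c < ts_floor T y) (at_left x)"
          unfolding eventually_at_left_field using s(3) by blast
      next
        fix c assume "x < c"
        obtain s where s: "s \<in> T" "s < x" using approx[of "x - 1"] by auto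
        have "ts_floor T y < c" if "s < y" "y < x" for y
          using ts_floor_in[OF T s(1), of y] that \<open>x < c\<close> by simp
        then show "eventually (\<lambda>y. ts_floor T y < c) (at_left x)"
          unfolding eventually_at_left_field using s(2) by blast
      qed
    qed
    then show ?thesis using filterlim_compose[OF l] by blast
  qed
  show "\<exists>r. (?g \<longlongrightarrow> r) (at_right x)"
  proof (cases "\<exists>p>x. T \<inter> {x<..<p} = {}")
    case True
    then obtain p where p: "x < p" "T \<inter> {x<..<p} = {}" by blast
    then have gap: "s \<le> x \<or> p \<le> s" if "s \<in> T" for s using that by force
    have "?g y = ?g x" if "x < y" "y < p" for y
    proof (intro arg_cong[where f = f] ts_floor_cong)
      fix s assume "s \<in> T"
      from gap[OF this] show "s \<le> y \<longleftrightarrow> s \<le> x" using that by linarith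
    qed
    then have "eventually (\<lambda>y. ?g y = ?g x) (at_right x)"
      unfolding eventually_at_right_field using p(1) by blast
    then show ?thesis by (blast intro: tendsto_eventually)
  next
    case False
    have approx: "\<exists>s\<in>T. x < s \<and> s < p" if "x < p" for p
    proof -
      from False that have "T \<inter> {x<..<p} \<noteq> {}" by blast
      then show ?thesis by auto
    qed
    have "x islimpt T"
      unfolding islimpt_approachable_real
    proof (intro allI impI)
      fix e :: real assume "0 < e"
      then show "\<exists>x'\<in>T. x' \<noteq> x \<and> \<bar>x' - x\<bar> < e" using approx[of "x + e"] by force
    qed
    with T have x: "x \<in> T" by (simp add: closed_limpt)
    have "\<not> x < fwd_jump T x"
    proof
      assume "x < fwd_jump T x"
      then obtain s where "s \<in> T" "x < s" "s < fwd_jump T x" using approx by blast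
      with fwd_jump_le[of s T x] show False by simp
    qed
    then have "fwd_jump T x = x" using fwd_jump_in[OF T x] by simp
    with x cont have c: "continuous (at x within T) f" by simp
    have "(ts_floor T \<longlongrightarrow> x) (at_right x)"
    proof (rule tendsto_sandwich[of "\<lambda>_. x" _ _ "\<lambda>y. y"])
      show "eventually (\<lambda>y. x \<le> ts_floor T y) (at_right x)"
           "eventually (\<lambda>y. ts_floor T y \<le> y) (at_right x)"
        using ts_floor_in[OF T x] by (auto simp: eventually_at_filter)
    qed (auto intro: tendsto_intros)
    moreover have "eventually (\<lambda>y. ts_floor T y \<in> T) (at_right x)"
      using ts_floor_in[OF T x] by (auto simp: eventually_at_filter)
    ultimately have "(?g \<longlongrightarrow> f x) (at_right x)"
      using c continuous_within_tendsto_compose by blast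
    then show ?thesis by blast
  qed
qed

text \<open>
  The first condition on \<open>f\<close> covers the right-dense points and a maximum of \<open>T\<close>; the second
  is void at points that are not left-dense. The continuity of \<open>f\<close> at a dense point \<open>t\<close> is
  enough to differentiate the integral of its extension there, because between \<open>t\<close> and a
  point \<open>s\<close> of \<open>T\<close> the extension only takes values of \<open>f\<close> between \<open>t\<close> and \<open>s\<close>.
\<close>
lemma delta_antiderivative_exists:
  fixes f :: "real \<Rightarrow> 'a::banach"
  assumes T: "closed T"
    and cont: "\<And>t. t \<in> T \<Longrightarrow> fwd_jump T t = t \<Longrightarrow> continuous (at t within T) f"
    and lim: "\<And>t. t \<in> T \<Longrightarrow> \<exists>l. (f \<longlongrightarrow> l) (at t within (T \<inter> {..<t}))"
  obtains F where "delta_antiderivative T f F"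
proof -
  define g where "g x = f (ts_floor T x)" for x
  have int: "g integrable_on {a..b}" for a b
    unfolding g_def by (intro regulated_integrable ts_floor_regulated assms)
  (* T may be unbounded below, so the integral from 0 is taken with orientation. *)
  define F where "F x = (if 0 \<le> x then integral {0..x} g else - integral {x..0} g)" for x
  have Fdiff: "F y - F x = integral {x..y} g" if "x \<le> y" for x y
  proof -
    consider "0 \<le> x" | "x < 0" "0 \<le> y" | "y < 0" by linarith
    then show ?thesis
    proof cases
      case 1
      then show ?thesis using Henstock_Kurzweil_Integration.integral_combine[where a = 0 and c = x and b = y and f = g] int that by (simp add: F_def algebra_simps)
    next
      case 2
      then show ?thesis using Henstock_Kurzweil_Integration.integral_combine[where a = x and c = 0 and b = y and f = g] int that by (simp add: F_def algebra_simps)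
    next
      case 3
      then show ?thesis using Henstock_Kurzweil_Integration.integral_combine[where a = x and c = y and b = 0 and f = g] int that by (simp add: F_def algebra_simps)
    qed
  qed
  have bound: "norm (F y - F x - (y - x) *\<^sub>R d) \<le> e * (y - x)"
    if "x \<le> y" "0 \<le> e" "\<And>z. z \<in> {x..y} \<Longrightarrow> norm (g z - d) \<le> e" for x y e d
  proof -
    have "((\<lambda>_. d) has_integral (y - x) *\<^sub>R d) {x..y}"
      using has_integral_const_real[of d x y] that(1) by (simp add: content_real)
    then have "((\<lambda>z. g z - d) has_integral (integral {x..y} g - (y - x) *\<^sub>R d)) {x..y}"
      by (intro has_integral_diff integrable_integral int)
    from has_integral_bound_real[OF that(2) _ this, of "{}"] that
    show ?thesis by (simp add: Fdiff content_real)
  qed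
  have Fcont: "isCont F t" for t
  proof -
    have "continuous_on {t-1..t+1} (\<lambda>x. F (t-1) + integral {t-1..x} g)"
      by (intro continuous_intros indefinite_integral_continuous_1 int)
    then have "continuous_on {t-1..t+1} F"
      by (rule continuous_on_eq) (use Fdiff in \<open>auto simp flip: Fdiff\<close>)
    then show ?thesis
      by (rule continuous_on_interior) simp
  qed
  have "has_delta_derivative T F (f t) t" if "t \<in> T" for t
  proof (cases "fwd_jump T t = t")
    case True
    show ?thesis unfolding has_delta_derivative_altdef True
    proof (intro allI impI)
      fix \<epsilon> :: real assume "\<epsilon> > 0"
      then obtain \<delta> where \<delta>: "\<delta> > 0" "\<And>s. s \<in> T \<Longrightarrow> \<bar>s - t\<bar> < \<delta> \<Longrightarrow> norm (f s - f t) < \<epsilon>"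
        using cont[OF \<open>t \<in> T\<close> True, unfolded continuous_within_eps_delta, rule_format, of \<epsilon>]
        unfolding dist_norm real_norm_def by blast
      have "norm (F t - F s - (t - s) *\<^sub>R f t) \<le> \<epsilon> * \<bar>t - s\<bar>" if s: "s \<in> T" "\<bar>s - t\<bar> < \<delta>" for s
      proof (cases "s \<le> t")
        case True
        have "norm (g z - f t) \<le> \<epsilon>" if "z \<in> {s..t}" for z
          unfolding g_def using ts_floor_in[OF T s(1), of z] s that by (intro less_imp_le \<delta>(2)) auto
        from bound[OF True _ this] \<open>\<epsilon> > 0\<close> True show ?thesis by simp
      next
        case False
        have "norm (g z - f t) \<le> \<epsilon>" if "z \<in> {t..s}" for z
          unfolding g_def using ts_floor_in[OF T \<open>t \<in> T\<close>, of z] s that by (intro less_imp_le \<delta>(2)) auto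
        from bound[OF _ _ this] \<open>\<epsilon> > 0\<close> False
        have "norm (F s - F t - (s - t) *\<^sub>R f t) \<le> \<epsilon> * (s - t)" by simp
        moreover have "F t - F s - (t - s) *\<^sub>R f t = - (F s - F t - (s - t) *\<^sub>R f t)"
          by (simp add: algebra_simps)
        ultimately have "norm (F t - F s - (t - s) *\<^sub>R f t) \<le> \<epsilon> * (s - t)" by (simp only: norm_minus_cancel)
        then show ?thesis using False by (simp add: abs_if)
      qed
      with \<delta>(1) show "\<exists>\<delta>>0. \<forall>s\<in>T. \<bar>s - t\<bar> < \<delta> \<longrightarrow> norm (F t - F s - (t - s) *\<^sub>R f t) \<le> \<epsilon> * \<bar>t - s\<bar>"
        by blast
    qed
  next
    case False
    show ?thesis
    proof (rule has_delta_derivativeI[OF T \<open>t \<in> T\<close>])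
      show "continuous (at t within T) F" using Fcont by (rule continuous_at_imp_continuous_within)
      assume lt: "t < fwd_jump T t"
      have "(g has_integral (graininess T t *\<^sub>R f t)) {t..fwd_jump T t}"
      proof (rule has_integral_spike_finite[of "{fwd_jump T t}" _ _ "\<lambda>_. f t"])
        show "((\<lambda>_. f t) has_integral (graininess T t *\<^sub>R f t)) {t..fwd_jump T t}"
          using has_integral_const_real[of "f t" t "fwd_jump T t"] lt
          by (simp add: graininess_def content_real)
      qed (use ts_floor_between_jump[OF T \<open>t \<in> T\<close>] in \<open>auto simp: g_def\<close>)
      then have "F (fwd_jump T t) - F t = graininess T t *\<^sub>R f t"
        using Fdiff lt by (simp add: integral_unique)
      then show "F (fwd_jump T t) = F t + graininess T t *\<^sub>R f t" by (simp add: algebra_simps)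
    qed (use False in auto)
  qed
  then show ?thesis
    using that by (auto simp: delta_antiderivative_def ts_kappa_def)
qed

section \<open>End points and the graininess\<close>
lemma not_left_dense_at_left:
  assumes "t \<in> T" "\<not> left_dense T t"
  shows "at t within (T \<inter> {..<t}) = bot"
proof (cases "\<exists>s\<in>T. s < t")
  case True
  then have ne: "{s \<in> T. s < t} \<noteq> {}" by auto
  have bdd: "bdd_above {s \<in> T. s < t}" by (rule bdd_aboveI[of _ t]) auto
  define p where "p = Sup {s \<in> T. s < t}"
  have "p \<le> t" unfolding p_def by (rule cSup_least[OF ne]) auto
  moreover have "bwd_jump T t = p" using ne by (simp only: bwd_jump_def p_def if_False)
  then have "p \<noteq> t" using assms(2) True by (auto simp: left_dense_def)
  ultimately have "p < t" by simp
  have "\<not> t islimpt (T \<inter> {..<t})"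
  proof
    assume "t islimpt (T \<inter> {..<t})"
    then obtain s where s: "s \<in> T" "s < t" "\<bar>s - t\<bar> < t - p"
      unfolding islimpt_approachable_real using \<open>p < t\<close> by (metis IntE diff_gt_0_iff_gt lessThan_iff)
    then have "s \<le> p" unfolding p_def using bdd by (intro cSup_upper) auto
    with s show False by simp
  qed
  then show ?thesis by (simp add: trivial_limit_within)
next
  case False
  then have "T \<inter> {..<t} = {}" by auto
  then show ?thesis by simp
qed

lemma at_within_max:
  fixes t :: real
  assumes "\<And>s. s \<in> T \<Longrightarrow> s \<le> t"
  shows "at t within T = at t within (T \<inter> {..<t})"
proof -
  have "s < t" if "s \<in> T" "s \<noteq> t" for s using assms[OF that(1)] that(2) by simp
  then have "T - {t} = (T \<inter> {..<t}) - {t}" by blast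
  then show ?thesis by (simp add: at_within_def)
qed

text \<open>
  Nothing lies to the right of the point that is removed in passing from \<open>T\<close> to \<open>T\<^sup>\<kappa>\<close>, and
  there is a gap to its left. Hence every function is continuous there, and the removal leaves a
  closed set.
\<close>
lemma ts_kappa_isolated:
  assumes "t \<in> T" "t \<notin> ts_kappa T"
  shows "at t within T = bot"
proof -
  have max: "\<And>s. s \<in> T \<Longrightarrow> s \<le> t" and "left_scattered T t"
    using assms by (auto simp: ts_kappa_def)
  then have "\<not> left_dense T t" by (auto simp: left_dense_def left_scattered_def)
  then show ?thesis using assms at_within_max[OF max] not_left_dense_at_left by metis
qed

lemma ts_kappaI:
  assumes "s \<in> T" "t \<in> T" "s < t"
  shows "s \<in> ts_kappa T"
  using assms by (force simp: ts_kappa_def)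

lemma ts_kappa_subset: "ts_kappa T \<subseteq> T"
  by (auto simp: ts_kappa_def)

lemma closed_ts_kappa:
  assumes "closed T" shows "closed (ts_kappa T)"
  unfolding closed_limpt
proof (intro allI impI)
  fix x assume x: "x islimpt ts_kappa T"
  then have "x islimpt T" by (rule islimpt_subset) (rule ts_kappa_subset)
  then have "x \<in> T" "at x within T \<noteq> bot" using assms by (auto simp: closed_limpt trivial_limit_within)
  then show "x \<in> ts_kappa T" using ts_kappa_isolated by blast
qed

lemma delta_differentiable_continuous:
  assumes "closed T" "t \<in> T" "t \<in> ts_kappa T \<Longrightarrow> has_delta_derivative T f d t"
  shows "continuous (at t within T) f"
proof (cases "t \<in> ts_kappa T")
  case True
  with assms has_delta_derivative_continuous show ?thesis by blast
next
  case False
  with assms ts_kappa_isolated[of t T] show ?thesis by (simp add: continuous_within)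
qed

lemma graininess_bounds:
  assumes "closed T" "s \<in> T" "r \<in> T" "s < r"
  shows "0 \<le> graininess T s" "graininess T s \<le> r - s"
  using fwd_jump_in[OF assms(1,2)] fwd_jump_le[OF assms(3,4)] by (auto simp: graininess_def)

text \<open>
  Near a dense point all gaps are short: a gap cannot reach beyond a later point of \<open>T\<close>.
  From the left the point \<open>t\<close> itself serves as that later point; from the right, right-density
  provides one.
\<close>
lemma graininess_tendsto_left:
  assumes "closed T" "t \<in> T"
  shows "(graininess T \<longlongrightarrow> 0) (at t within (T \<inter> {..<t}))"
proof (rule tendstoI)
  fix e :: real assume "e > 0"
  have "dist (graininess T s) 0 < e" if "s \<in> T" "s < t" "dist s t < e" for s
    using graininess_bounds[OF assms(1) that(1) assms(2) that(2)] that by (simp add: dist_norm)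
  then show "eventually (\<lambda>s. dist (graininess T s) 0 < e) (at t within (T \<inter> {..<t}))"
    unfolding eventually_at using \<open>e > 0\<close> by blast
qed

lemma graininess_tendsto:
  assumes "closed T" "t \<in> T" "fwd_jump T t = t"
  shows "(graininess T \<longlongrightarrow> 0) (at t within T)"
proof (cases "\<exists>r\<in>T. t < r")
  case True
  then obtain r0 where r0: "r0 \<in> T" "t < r0" by blast
  show ?thesis
  proof (rule tendstoI)
    fix e :: real assume "e > 0"
    obtain r where r: "r \<in> T" "t < r" "r < t + e"
      using right_dense_approx[OF r0 assms(3) \<open>e > 0\<close>] .
    have "dist (graininess T s) 0 < e" if s: "s \<in> T" "s \<noteq> t" "dist s t < min e (r - t)" for s
    proof (cases "s < t")
      case True
      then show ?thesis
        using graininess_bounds[OF assms(1) s(1) assms(2) True] s by (simp add: dist_norm)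
    next
      case False
      with s have "s < r" by (simp add: dist_norm)
      then show ?thesis using graininess_bounds[OF assms(1) s(1) r(1)] False r by (simp add: dist_norm)
    qed
    then show "eventually (\<lambda>s. dist (graininess T s) 0 < e) (at t within T)"
      unfolding eventually_at using \<open>e > 0\<close> r(2) by (intro exI[of _ "min e (r - t)"]) auto
  qed
next
  case False
  then have "at t within T = at t within (T \<inter> {..<t})" by (intro at_within_max) force
  then show ?thesis using graininess_tendsto_left[OF assms(1,2)] by simp
qed

section \<open>The exponential function\<close>

text \<open>
  The cylinder transformation is \<open>z * \<phi>(h z)\<close> with \<open>\<phi>(w) = Ln (1 + w) / w\<close>, where \<open>\<phi>(0) = 1\<close>
  makes \<open>\<phi>\<close> continuous at 0.
\<close>
lemma cylinder_tendsto:
  assumes "(h \<longlongrightarrow> 0) F" "(z \<longlongrightarrow> l) F"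
  shows "((\<lambda>s. cylinder (h s) (z s)) \<longlongrightarrow> l) F"
proof -
  define \<phi> :: "complex \<Rightarrow> complex" where "\<phi> w = (if w = 0 then 1 else Ln (1 + w) / w)" for w
  have "(Ln has_field_derivative inverse 1) (at (1::complex))"
    by (rule has_field_derivative_Ln) simp
  then have "((\<lambda>w::complex. Ln (1 + w) / w) \<longlongrightarrow> 1) (at 0)" by (simp add: DERIV_def)
  then have "(\<phi> \<longlongrightarrow> 1) (at 0)"
    by (rule Lim_transform_eventually) (auto simp: \<phi>_def eventually_at_filter)
  then have "isCont \<phi> 0" by (simp add: isCont_def \<phi>_def)
  moreover have "((\<lambda>s. of_real (h s) * z s) \<longlongrightarrow> of_real 0 * l) F" using assms by (intro tendsto_intros)
  ultimately have "((\<lambda>s. \<phi> (of_real (h s) * z s)) \<longlongrightarrow> \<phi> 0) F"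
    by (intro isCont_tendsto_compose[of 0 \<phi>]) auto
  with assms have "((\<lambda>s. z s * \<phi> (of_real (h s) * z s)) \<longlongrightarrow> l * \<phi> 0) F" by (intro tendsto_intros)
  moreover have "cylinder a b = b * \<phi> (of_real a * b)" for a b
    by (simp add: cylinder_def \<phi>_def)
  ultimately show ?thesis by (simp add: \<phi>_def)
qed

text \<open>
  A point fixed by the forward jump is right-dense or the maximum of \<open>T\<close>, and only at a
  left-dense maximum can an rd-continuous function fail to be continuous there.
\<close>
lemma rd_continuous_imp_continuous_at:
  assumes "closed T" "rd_continuous T q" "t \<in> T" "fwd_jump T t = t"
    and max: "(\<And>s. s \<in> T \<Longrightarrow> s \<le> t) \<Longrightarrow> left_dense T t \<Longrightarrow> continuous (at t within T) q"
  shows "continuous (at t within T) q"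
proof (cases "right_dense T t")
  case True
  with assms show ?thesis by (auto simp: rd_continuous_def)
next
  case False
  with assms(4) have m: "s \<le> t" if "s \<in> T" for s using that by (force simp: right_dense_def)
  show ?thesis
  proof (cases "left_dense T t")
    case False
    with not_left_dense_at_left[OF assms(3)] at_within_max[OF m] show ?thesis
      by (simp add: continuous_within)
  qed (use max m in blast)
qed

text \<open>
  The exponential is \<open>exp (F t - F t0)\<close> for an antiderivative \<open>F\<close> of the transformed rate. At a
  jump it is multiplied by \<open>exp (Ln (1 + \<mu> q)) = 1 + \<mu> q\<close>, also where
  this is negative and the logarithm is not real, so it solves the linear equation with the real rate \<open>q\<close>. Its conjugate does so too,
  with the same initial value, and therefore the exponential is real.
\<close>
lemma ts_exp_dynamic_equation:
  assumes T: "closed T" "t0 \<in> T" and q: "rd_continuous T q"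
    and max: "\<And>m. m \<in> T \<Longrightarrow> (\<And>s. s \<in> T \<Longrightarrow> s \<le> m) \<Longrightarrow> left_dense T m \<Longrightarrow> continuous (at m within T) q"
    and reg: "\<And>t. t \<in> ts_kappa T \<Longrightarrow> 1 + graininess T t * q t \<noteq> 0"
  obtains e :: "real \<Rightarrow> real"
  where "e t0 = 1"
    and "\<And>t. t \<in> T \<Longrightarrow> t0 \<le> t \<Longrightarrow> ts_exp T q t t0 = of_real (e t)"
    and "\<And>t. t \<in> T \<Longrightarrow> t0 \<le> t \<Longrightarrow> e t \<noteq> 0"
    and "\<And>t. t \<in> ts_kappa T \<Longrightarrow> has_delta_derivative T e (q t * e t) t"
proof -
  define f where "f t = cylinder (graininess T t) (of_real (q t))" for t
  obtain F where F: "delta_antiderivative T f F"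
  proof (rule delta_antiderivative_exists[OF T(1), of f])
    fix t assume t: "t \<in> T"
    { assume s: "fwd_jump T t = t"
      have "continuous (at t within T) q"
        using T(1) q t s max[OF t] by (rule rd_continuous_imp_continuous_at)
      then have "((\<lambda>s. complex_of_real (q s)) \<longlongrightarrow> of_real (q t)) (at t within T)"
        by (intro tendsto_of_real) (simp add: continuous_within)
      then show "continuous (at t within T) f"
        using cylinder_tendsto[OF graininess_tendsto[OF T(1) t s], of "\<lambda>s. of_real (q s)"]
        by (simp add: continuous_within f_def[abs_def] graininess_def[of T t] s cylinder_def[of 0]) }
    show "\<exists>l. (f \<longlongrightarrow> l) (at t within (T \<inter> {..<t}))"
    proof (cases "left_dense T t")
      case True
      then obtain l where "(q \<longlongrightarrow> l) (at t within (T \<inter> {..<t}))" using q t by (auto simp: rd_continuous_def)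
      then have "((\<lambda>s. complex_of_real (q s)) \<longlongrightarrow> of_real l) (at t within (T \<inter> {..<t}))"
        by (rule tendsto_of_real)
      then show ?thesis
        using cylinder_tendsto[OF graininess_tendsto_left[OF T(1) t]] unfolding f_def by blast
    qed (simp add: not_left_dense_at_left t)
  qed blast
  have FD: "has_delta_derivative T F (f t) t" if "t \<in> ts_kappa T" for t
    using F that by (simp add: delta_antiderivative_def)
  define E where "E t = exp (F t - F t0)" for t
  have "delta_integral T f t0 t = F t - F t0" if t: "t \<in> T" "t0 \<le> t" for t
    unfolding delta_integral_def
  proof (rule the_equality)
    show "\<exists>G. delta_antiderivative T f G \<and> F t - F t0 = G t - G t0" using F by blast
  next
    fix I assume "\<exists>G. delta_antiderivative T f G \<and> I = G t - G t0"
    then obtain G where G: "delta_antiderivative T f G" and I: "I = G t - G t0" by blast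
    have D: "has_delta_derivative T (\<lambda>s. G s + - F s) 0 s" if "s \<in> ts_kappa T" for s
    proof -
      have s: "s \<in> T" using that ts_kappa_subset by blast
      have "has_delta_derivative T (\<lambda>s. - F s) (- f s) s"
        using has_delta_derivative_linear[OF bounded_linear_minus[OF bounded_linear_ident] T(1) s FD[OF that]] .
      from has_delta_derivative_add[OF T(1) s _ this, of G "f s"] G that show ?thesis
        by (simp add: delta_antiderivative_def)
    qed
    have "G t + - F t = G t0 + - F t0"
    proof (rule delta_derivative_zero_imp_constant[OF T(1) T(2) t])
      show "has_delta_derivative T (\<lambda>s. G s + - F s) 0 s" if "s \<in> T" "t0 \<le> s" "s < t" for s
        using D ts_kappaI[OF that(1) t(1) that(3)] by blast
      show "continuous (at t within T) (\<lambda>s. G s + - F s)"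
        using delta_differentiable_continuous[OF T(1) t(1) D] .
    qed
    then show "I = F t - F t0" using I by algebra
  qed
  then have exp_E: "ts_exp T q t t0 = E t" if "t \<in> T" "t0 \<le> t" for t
    using that by (simp add: ts_exp_def E_def f_def[abs_def])
  have ED: "has_delta_derivative T E (q t *\<^sub>R E t) t" if tk: "t \<in> ts_kappa T" for t
  proof -
    have t: "t \<in> T" using tk ts_kappa_subset by blast
    note Ft = FD[OF tk]
    show ?thesis
    proof (rule has_delta_derivativeI[OF T(1) t])
      assume s: "fwd_jump T t = t"
      have "f t = of_real (q t)" by (simp add: f_def graininess_def s cylinder_def)
      then have "((\<lambda>s. F s - F t0) has_vector_derivative of_real (q t)) (at t within T)"
        using Ft s by (auto simp: has_delta_derivative_dense intro!: derivative_eq_intros)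
      then have "(exp \<circ> (\<lambda>s. F s - F t0) has_vector_derivative (of_real (q t) * exp (F t - F t0))) (at t within T)"
        by (rule field_vector_diff_chain_within) (auto intro!: derivative_eq_intros)
      then show "(E has_vector_derivative q t *\<^sub>R E t) (at t within T)"
        by (simp add: E_def[abs_def] o_def scaleR_conv_of_real)
    next
      show "continuous (at t within T) E"
        unfolding E_def using has_delta_derivative_continuous[OF T(1) t Ft] by (intro continuous_intros)
    next
      assume "t < fwd_jump T t"
      then have m: "graininess T t \<noteq> 0" by (simp add: graininess_def)
      have nz: "1 + complex_of_real (graininess T t) * of_real (q t) \<noteq> 0"
        using reg[OF tk] by (metis of_real_1 of_real_add of_real_eq_0_iff of_real_mult)
      have "graininess T t *\<^sub>R f t = Ln (1 + of_real (graininess T t) * of_real (q t))"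
        using m by (simp add: f_def cylinder_def scaleR_conv_of_real)
      then have "F (fwd_jump T t) - F t0 =
          (F t - F t0) + Ln (1 + of_real (graininess T t) * of_real (q t))"
        using has_delta_derivative_jump[OF T(1) t Ft] by simp
      then have "E (fwd_jump T t) = E t * (1 + of_real (graininess T t) * of_real (q t))"
        by (simp only: E_def exp_add exp_Ln[OF nz])
      then show "E (fwd_jump T t) = E t + graininess T t *\<^sub>R q t *\<^sub>R E t"
        by (simp add: scaleR_conv_of_real algebra_simps)
    qed
  qed
  have real: "E t = of_real (Re (E t))" if t: "t \<in> T" "t0 \<le> t" for t
  proof -
    have CD: "has_delta_derivative T (\<lambda>s. cnj (E s)) (q s *\<^sub>R cnj (E s)) s" if "s \<in> ts_kappa T" for s
      using has_delta_derivative_linear[OF bounded_linear_cnj T(1) _ ED[OF that]] that ts_kappa_subset by auto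
    have "cnj (E t) / E t = cnj (E t0) / E t0"
    proof (rule delta_linear_unique[OF T(1) T(2) t])
      fix s assume "s \<in> T" "t0 \<le> s" "s < t"
      then have "s \<in> ts_kappa T" using ts_kappaI t by blast
      then show "has_delta_derivative T (\<lambda>s. cnj (E s)) (q s *\<^sub>R cnj (E s)) s"
                "has_delta_derivative T E (q s *\<^sub>R E s) s" using ED CD by blast+
    next
      show "continuous (at t within T) (\<lambda>s. cnj (E s))" "continuous (at t within T) E"
        using delta_differentiable_continuous[OF T(1) t(1) CD]
          delta_differentiable_continuous[OF T(1) t(1) ED] by blast+
    qed (simp add: E_def)
    then have "cnj (E t) = E t" by (simp add: E_def)
    then have "E t \<in> \<real>" by (simp add: Reals_cnj_iff)
    then show ?thesis by (metis of_real_Re)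
  qed
  show ?thesis
  proof (rule that[of "\<lambda>t. Re (E t)"])
    show "Re (E t0) = 1" by (simp add: E_def)
    fix t
    { assume t: "t \<in> T" "t0 \<le> t"
      then show "ts_exp T q t t0 = of_real (Re (E t))" using real exp_E by simp
      have "E t \<noteq> 0" by (simp add: E_def)
      then show "Re (E t) \<noteq> 0" using real[OF t] by auto }
    assume "t \<in> ts_kappa T"
    then show "has_delta_derivative T (\<lambda>t. Re (E t)) (q t * Re (E t)) t"
      using has_delta_derivative_linear[OF bounded_linear_Re T(1) _ ED[of t]] ts_kappa_subset by auto
  qed
qed

section \<open>The exponential on smaller time scales\<close>
lemma fwd_jump_restrict:
  assumes "X \<subseteq> T" "r \<in> X" "t < r" "\<And>s. s \<in> T \<Longrightarrow> t < s \<Longrightarrow> s \<le> r \<Longrightarrow> s \<in> X"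
  shows "fwd_jump X t = fwd_jump T t"
proof -
  let ?A = "{s \<in> X. t < s}" and ?B = "{s \<in> T. t < s}"
  have ne: "?A \<noteq> {}" "?B \<noteq> {}" using assms by auto
  have bdd: "bdd_below ?A" "bdd_below ?B" by (auto simp: bdd_below_def intro: less_imp_le)
  have "Inf ?B \<le> Inf ?A" using ne bdd assms(1) by (intro cInf_superset_mono) auto
  moreover have "Inf ?A \<le> Inf ?B"
  proof (rule cInf_greatest[OF ne(2)])
    fix s assume s: "s \<in> ?B"
    show "Inf ?A \<le> s"
    proof (cases "s \<le> r")
      case True
      with s assms(4) bdd show ?thesis by (intro cInf_lower) auto
    next
      case False
      have "Inf ?A \<le> r" using bdd assms by (intro cInf_lower) auto
      with False show ?thesis by simp
    qed
  qed
  ultimately have "Inf ?A = Inf ?B" by simp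
  then show ?thesis by (simp only: fwd_jump_def ne if_False)
qed

lemma fwd_jump_atLeast:
  assumes "t \<in> T" "a \<le> t"
  shows "fwd_jump (T \<inter> {a..}) t = fwd_jump T t"
proof (cases "\<exists>r\<in>T. t < r")
  case True
  then obtain r where "r \<in> T" "t < r" by blast
  then show ?thesis using assms by (intro fwd_jump_restrict[of _ _ r]) auto
next
  case False
  then have "s \<le> t" if "s \<in> T" for s using that by force
  then show ?thesis using assms fwd_jump_max[of t T] fwd_jump_max[of t "T \<inter> {a..}"] by simp
qed

lemma fwd_jump_ts_kappa:
  assumes "t \<in> ts_kappa T" "r \<in> ts_kappa T" "t < r"
  shows "fwd_jump (ts_kappa T) t = fwd_jump T t"
proof (rule fwd_jump_restrict[OF ts_kappa_subset assms(2,3)])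
  fix s assume "s \<in> T" "s \<le> r"
  then show "s \<in> ts_kappa T"
    using assms(2) ts_kappaI[of s T r] ts_kappa_subset by (cases "s = r") auto
qed

lemma bwd_jump_ts_kappa:
  assumes "t \<in> ts_kappa T" "r \<in> ts_kappa T" "r < t"
  shows "bwd_jump (ts_kappa T) t = bwd_jump T t"
proof -
  have "{s \<in> ts_kappa T. s < t} = {s \<in> T. s < t}"
    using assms(1) ts_kappaI[of _ T t] ts_kappa_subset by blast
  moreover have "{s \<in> ts_kappa T. s < t} \<noteq> {}" using assms by auto
  ultimately show ?thesis by (simp only: bwd_jump_def if_False)
qed

lemma rd_continuous_ts_kappa:
  assumes "rd_continuous T q"
  shows "rd_continuous (ts_kappa T) q"
  unfolding rd_continuous_def
proof (intro conjI ballI impI)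
  fix t assume t: "t \<in> ts_kappa T"
  then have tT: "t \<in> T" using ts_kappa_subset by blast
  { assume rd: "right_dense (ts_kappa T) t"
    then obtain r where "r \<in> ts_kappa T" "t < r" by (auto simp: right_dense_def)
    with rd fwd_jump_ts_kappa[OF t this] have "right_dense T t"
      using ts_kappa_subset[of T] by (auto simp: right_dense_def)
    with assms tT have "continuous (at t within T) q" by (simp add: rd_continuous_def)
    then show "continuous (at t within ts_kappa T) q"
      using ts_kappa_subset continuous_within_subset by blast }
  assume ld: "left_dense (ts_kappa T) t"
  then obtain r where "r \<in> ts_kappa T" "r < t" by (auto simp: left_dense_def)
  with ld bwd_jump_ts_kappa[OF t this] have "left_dense T t"
    using ts_kappa_subset[of T] by (auto simp: left_dense_def)
  then obtain l where "(q \<longlongrightarrow> l) (at t within (T \<inter> {..<t}))"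
    using assms tT by (auto simp: rd_continuous_def)
  then have "(q \<longlongrightarrow> l) (at t within (ts_kappa T \<inter> {..<t}))"
    by (rule tendsto_within_subset) (use ts_kappa_subset[of T] in auto)
  then show "\<exists>l. (q \<longlongrightarrow> l) (at t within (ts_kappa T \<inter> {..<t}))" by blast
qed

lemma has_delta_derivative_atLeast:
  assumes "t \<in> T" "a \<le> t" "has_delta_derivative T f d t"
  shows "has_delta_derivative (T \<inter> {a..}) f d t"
  using assms by (intro has_delta_derivative_subset[OF assms(3)]) (auto simp: fwd_jump_atLeast)

text \<open>
  For the last property it does not suffice to restrict the derivative from \<open>T\<close>: at a maximum of
  \<open>T\<^sup>\<kappa>\<close> the forward jumps in \<open>T\<close> and in \<open>T\<^sup>\<kappa>\<close> may differ. The exponential \<open>e'\<close> built on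
  \<open>T\<^sup>\<kappa>\<close> has the desired derivative, and it equals \<open>e\<close> on \<open>T\<^sup>\<kappa>\<close> because before the maximum
  both solve the same equation and both are continuous.
\<close>
lemma ts_exp_forward:
  assumes T: "closed T" and t0: "t0 \<in> ts_kappa T" and q: "rd_continuous T q"
    and max: "\<And>m. m \<in> ts_kappa T \<Longrightarrow> (\<And>s. s \<in> ts_kappa T \<Longrightarrow> s \<le> m) \<Longrightarrow> left_dense (ts_kappa T) m
        \<Longrightarrow> continuous (at m within ts_kappa T) q"
    and reg: "\<And>t. t \<in> ts_kappa T \<Longrightarrow> 1 + graininess T t * q t \<noteq> 0"
  obtains e :: "real \<Rightarrow> real"
  where "e t0 = 1"
    and "\<And>t. t \<in> T \<Longrightarrow> t0 \<le> t \<Longrightarrow> ts_exp T q t t0 = of_real (e t)"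
    and "\<And>t. t \<in> T \<Longrightarrow> t0 \<le> t \<Longrightarrow> e t \<noteq> 0"
    and "\<And>t. t \<in> ts_kappa T \<Longrightarrow> t0 \<le> t \<Longrightarrow> has_delta_derivative (T \<inter> {t0..}) e (q t * e t) t"
    and "\<And>t. t \<in> ts_kappa (ts_kappa T) \<Longrightarrow> t0 \<le> t \<Longrightarrow>
           has_delta_derivative (ts_kappa T \<inter> {t0..}) e (q t * e t) t"
proof -
  define S where "S = ts_kappa T"
  have S: "closed S" "S \<subseteq> T" "t0 \<in> S" "t0 \<in> T"
    using closed_ts_kappa[OF T] ts_kappa_subset[of T] t0 by (auto simp: S_def)
  obtain e :: "real \<Rightarrow> real" where e: "e t0 = 1"
    "\<And>t. t \<in> T \<Longrightarrow> t0 \<le> t \<Longrightarrow> ts_exp T q t t0 = of_real (e t)"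
    "\<And>t. t \<in> T \<Longrightarrow> t0 \<le> t \<Longrightarrow> e t \<noteq> 0"
    "\<And>t. t \<in> S \<Longrightarrow> has_delta_derivative T e (q t * e t) t"
  proof (rule ts_exp_dynamic_equation[OF T S(4) q])
    fix m assume m: "m \<in> T" "\<And>s. s \<in> T \<Longrightarrow> s \<le> m" "left_dense T m"
    then have "\<not> left_scattered T m" by (auto simp: left_dense_def left_scattered_def)
    then have "ts_kappa T = T" using m by (auto simp: ts_kappa_def dest: antisym)
    with max[of m] m show "continuous (at m within T) q" by simp
  qed (use reg S_def in auto)
  obtain e' :: "real \<Rightarrow> real" where e': "e' t0 = 1"
    "\<And>t. t \<in> S \<Longrightarrow> t0 \<le> t \<Longrightarrow> e' t \<noteq> 0"
    "\<And>t. t \<in> ts_kappa S \<Longrightarrow> has_delta_derivative S e' (q t * e' t) t"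
  proof (rule ts_exp_dynamic_equation[OF S(1,3)])
    show "rd_continuous S q" unfolding S_def using q by (rule rd_continuous_ts_kappa)
    show "continuous (at m within S) q"
      if "m \<in> S" "\<And>s. s \<in> S \<Longrightarrow> s \<le> m" "left_dense S m" for m
      using max that unfolding S_def by blast
    fix t assume "t \<in> ts_kappa S"
    then have t: "t \<in> S" using ts_kappa_subset by blast
    show "1 + graininess S t * q t \<noteq> 0"
    proof (cases "\<exists>r\<in>S. t < r")
      case True
      then have "graininess S t = graininess T t"
        using fwd_jump_ts_kappa t unfolding graininess_def S_def by auto
      with reg t show ?thesis by (simp add: S_def)
    next
      case False
      then have "fwd_jump S t = t" using t by (intro fwd_jump_max) force+
      then show ?thesis by (simp add: graininess_def)
    qed
  qed blast
  have eq: "e b = e' b" if b: "b \<in> S" "t0 \<le> b" for b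
  proof -
    have "e b / e' b = e t0 / e' t0"
    proof (rule delta_linear_unique[OF S(1,3) b, where q = q])
      fix t assume t: "t \<in> S" "t0 \<le> t" "t < b"
      have "fwd_jump S t = fwd_jump T t"
        using t b unfolding S_def by (intro fwd_jump_ts_kappa)
      then show "has_delta_derivative S e (q t *\<^sub>R e t) t"
        using has_delta_derivative_subset[OF e(4)[OF t(1)] S(2)] by simp
      show "has_delta_derivative S e' (q t *\<^sub>R e' t) t"
        using e'(3) ts_kappaI[OF t(1) b(1) t(3)] by simp
    next
      have "b \<in> T" using b S by blast
      from has_delta_derivative_continuous[OF T this e(4)[OF b(1)]]
      show "continuous (at b within S) e" using S(2) continuous_within_subset by blast
      show "continuous (at b within S) e'"
        using delta_differentiable_continuous[OF S(1) b(1) e'(3)] .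
    qed (use e' in auto)
    then show ?thesis using e' e(1) b by simp
  qed
  show ?thesis
  proof (rule that[OF e(1-3)])
    fix t
    show "has_delta_derivative (T \<inter> {t0..}) e (q t * e t) t" if "t \<in> ts_kappa T" "t0 \<le> t"
      using that e(4)[of t] S by (intro has_delta_derivative_atLeast) (auto simp: S_def)
    assume t: "t \<in> ts_kappa (ts_kappa T)" "t0 \<le> t"
    then have tS: "t \<in> S" using ts_kappa_subset S_def by blast
    have "has_delta_derivative (S \<inter> {t0..}) e' (q t * e' t) t"
      using e'(3)[of t] t tS by (intro has_delta_derivative_atLeast) (auto simp: S_def)
    moreover have "has_delta_derivative (S \<inter> {t0..}) e (q t * e' t) t =
        has_delta_derivative (S \<inter> {t0..}) e' (q t * e' t) t"
      using S(1) tS t eq by (intro has_delta_derivative_cong) auto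
    ultimately show "has_delta_derivative (ts_kappa T \<inter> {t0..}) e (q t * e t) t"
      using eq[OF tS t(2)] by (simp add: S_def)
  qed auto
qed

section \<open>The conformable equation\<close>

text \<open>
  Here and below \<open>p\<close> and \<open>m\<close> stand for the exponentials with \<open>+\<gamma>\<close> and \<open>-\<gamma>\<close>. The first
  conformable derivative of \<open>a p + b m\<close> is \<open>\<gamma> (a p - b m)\<close>.
\<close>
lemma exp_combination_is_conf_solution:
  assumes "closed T"
    and k0: "\<And>t. t \<in> T \<Longrightarrow> \<kappa>0 \<alpha> t \<noteq> 0"
    and p: "\<And>t. t \<in> ts_kappa T \<Longrightarrow> t0 \<le> t \<Longrightarrow>
        has_delta_derivative (T \<inter> {t0..}) p (conf_rate \<kappa>0 \<kappa>1 \<alpha> (\<lambda>_. \<gamma>) t * p t) t"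
      "\<And>t. t \<in> ts_kappa (ts_kappa T) \<Longrightarrow> t0 \<le> t \<Longrightarrow>
        has_delta_derivative (ts_kappa T \<inter> {t0..}) p (conf_rate \<kappa>0 \<kappa>1 \<alpha> (\<lambda>_. \<gamma>) t * p t) t"
    and m: "\<And>t. t \<in> ts_kappa T \<Longrightarrow> t0 \<le> t \<Longrightarrow>
        has_delta_derivative (T \<inter> {t0..}) m (conf_rate \<kappa>0 \<kappa>1 \<alpha> (\<lambda>_. - \<gamma>) t * m t) t"
      "\<And>t. t \<in> ts_kappa (ts_kappa T) \<Longrightarrow> t0 \<le> t \<Longrightarrow>
        has_delta_derivative (ts_kappa T \<inter> {t0..}) m (conf_rate \<kappa>0 \<kappa>1 \<alpha> (\<lambda>_. - \<gamma>) t * m t) t"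
  shows "conf_solution T \<kappa>0 \<kappa>1 \<alpha> \<gamma> t0 (\<lambda>t. a * p t + b * m t)"
  unfolding conf_solution_def
proof (intro exI conjI ballI)
  note comb = has_delta_derivative_add[OF _ _
    has_delta_derivative_linear[OF bounded_linear_mult_right]
    has_delta_derivative_linear[OF bounded_linear_mult_right]]
  let ?y = "\<lambda>t. a * p t + b * m t" and ?u = "\<lambda>t. (\<gamma> * a) * p t + (- \<gamma> * b) * m t"
  show "has_conf_derivative (T \<inter> {t0..}) \<kappa>0 \<kappa>1 \<alpha> ?y (?u t) t" if "t \<in> ts_kappa T \<inter> {t0..}" for t
  proof -
    have t: "t \<in> T" "t0 \<le> t" using that ts_kappa_subset by auto
    have "has_delta_derivative (T \<inter> {t0..}) ?y
        (a * (conf_rate \<kappa>0 \<kappa>1 \<alpha> (\<lambda>_. \<gamma>) t * p t) + b * (conf_rate \<kappa>0 \<kappa>1 \<alpha> (\<lambda>_. - \<gamma>) t * m t)) t"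
      using that t assms(1) by (intro comb p m) auto
    moreover have "?u t = \<kappa>1 \<alpha> t * ?y t + \<kappa>0 \<alpha> t *
        (a * (conf_rate \<kappa>0 \<kappa>1 \<alpha> (\<lambda>_. \<gamma>) t * p t) + b * (conf_rate \<kappa>0 \<kappa>1 \<alpha> (\<lambda>_. - \<gamma>) t * m t))"
      using k0[OF t(1)] by (simp add: conf_rate_def field_simps)
    ultimately show ?thesis unfolding has_conf_derivative_def by blast
  qed
  fix t assume that: "t \<in> ts_kappa (ts_kappa T) \<inter> {t0..}"
  then have t: "t \<in> ts_kappa T" "t \<in> T" "t0 \<le> t" using ts_kappa_subset by auto
  have "has_delta_derivative (ts_kappa T \<inter> {t0..}) ?u
      ((\<gamma> * a) * (conf_rate \<kappa>0 \<kappa>1 \<alpha> (\<lambda>_. \<gamma>) t * p t) + (- \<gamma> * b) * (conf_rate \<kappa>0 \<kappa>1 \<alpha> (\<lambda>_. - \<gamma>) t * m t)) t"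
    using that t closed_ts_kappa[OF assms(1)] by (intro comb p m) auto
  moreover have "\<gamma>\<^sup>2 * ?y t = \<kappa>1 \<alpha> t * ?u t + \<kappa>0 \<alpha> t *
      ((\<gamma> * a) * (conf_rate \<kappa>0 \<kappa>1 \<alpha> (\<lambda>_. \<gamma>) t * p t) + (- \<gamma> * b) * (conf_rate \<kappa>0 \<kappa>1 \<alpha> (\<lambda>_. - \<gamma>) t * m t))"
    using k0[OF t(2)] by (simp add: conf_rate_def field_simps power2_eq_square)
  ultimately show "has_conf_derivative (ts_kappa T \<inter> {t0..}) \<kappa>0 \<kappa>1 \<alpha> ?u (\<gamma>\<^sup>2 * ?y t) t"
    unfolding has_conf_derivative_def by blast
  show "\<gamma>\<^sup>2 * ?y t - \<gamma>\<^sup>2 * ?y t = 0" by simp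
qed

text \<open>
  For \<open>c = \<gamma>\<close> and \<open>c = -\<gamma>\<close>, the function \<open>u + c y\<close> has derivative
  \<open>(\<gamma>\<^sup>2 y - \<kappa>\<^sub>1 u + c (u - \<kappa>\<^sub>1 y)) / \<kappa>\<^sub>0 = ((c - \<kappa>\<^sub>1) / \<kappa>\<^sub>0) (u + c y)\<close>, hence is a multiple of the
  exponential for \<open>c\<close>. Subtracting the two gives \<open>y\<close> on \<open>T\<^sup>\<kappa>\<close>.
\<close>
lemma conf_solution_is_exp_combination:
  assumes T: "closed T" and t0: "t0 \<in> ts_kappa T" and "\<gamma> \<noteq> 0"
    and k0: "\<And>t. t \<in> T \<Longrightarrow> \<kappa>0 \<alpha> t \<noteq> 0"
    and p: "p t0 = 1" "\<And>t. t \<in> T \<Longrightarrow> t0 \<le> t \<Longrightarrow> p t \<noteq> 0"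
      "\<And>t. t \<in> ts_kappa T \<Longrightarrow> t0 \<le> t \<Longrightarrow>
        has_delta_derivative (T \<inter> {t0..}) p (conf_rate \<kappa>0 \<kappa>1 \<alpha> (\<lambda>_. \<gamma>) t * p t) t"
    and m: "m t0 = 1" "\<And>t. t \<in> T \<Longrightarrow> t0 \<le> t \<Longrightarrow> m t \<noteq> 0"
      "\<And>t. t \<in> ts_kappa T \<Longrightarrow> t0 \<le> t \<Longrightarrow>
        has_delta_derivative (T \<inter> {t0..}) m (conf_rate \<kappa>0 \<kappa>1 \<alpha> (\<lambda>_. - \<gamma>) t * m t) t"
    and y: "conf_solution T \<kappa>0 \<kappa>1 \<alpha> \<gamma> t0 y"
  shows "\<exists>a b. \<forall>t\<in>T. t0 \<le> t \<longrightarrow> y t = a * p t + b * m t"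
proof -
  define S where "S = ts_kappa T"
  define X where "X = T \<inter> {t0..}"
  define R where "R = S \<inter> {t0..}"
  have S: "closed S" "S \<subseteq> T" "t0 \<in> S" "t0 \<in> T"
    using closed_ts_kappa[OF T] ts_kappa_subset[of T] t0 by (auto simp: S_def)
  have R: "closed R" "t0 \<in> R" "R \<subseteq> X" "closed X" using S T by (auto simp: R_def X_def)
  obtain u v where u: "\<And>t. t \<in> R \<Longrightarrow> has_conf_derivative X \<kappa>0 \<kappa>1 \<alpha> y (u t) t"
    and v: "\<And>t. t \<in> ts_kappa S \<Longrightarrow> t0 \<le> t \<Longrightarrow> has_conf_derivative R \<kappa>0 \<kappa>1 \<alpha> u (v t) t"
      "\<And>t. t \<in> ts_kappa S \<Longrightarrow> t0 \<le> t \<Longrightarrow> v t = \<gamma>\<^sup>2 * y t"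
    using y unfolding conf_solution_def S_def R_def X_def by force
  define dy where "dy t = (u t - \<kappa>1 \<alpha> t * y t) / \<kappa>0 \<alpha> t" for t
  define du where "du t = (\<gamma>\<^sup>2 * y t - \<kappa>1 \<alpha> t * u t) / \<kappa>0 \<alpha> t" for t
  have yD: "has_delta_derivative X y (dy t) t" if tR: "t \<in> R" for t
  proof -
    obtain d where d: "has_delta_derivative X y d t" "u t = \<kappa>1 \<alpha> t * y t + \<kappa>0 \<alpha> t * d"
      using u[OF tR] by (auto simp: has_conf_derivative_def)
    then have "dy t = d" using k0[of t] tR R by (auto simp: dy_def X_def)
    with d show ?thesis by simp
  qed
  have uD: "has_delta_derivative R u (du t) t" if tS: "t \<in> ts_kappa S" "t0 \<le> t" for t
  proof -
    obtain d where d: "has_delta_derivative R u d t" "\<gamma>\<^sup>2 * y t = \<kappa>1 \<alpha> t * u t + \<kappa>0 \<alpha> t * d"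
      using v[OF tS] by (auto simp: has_conf_derivative_def)
    moreover have "t \<in> T" using tS S ts_kappa_subset by blast
    ultimately have "du t = d" using k0[of t] by (auto simp: du_def)
    with d show ?thesis by simp
  qed
  (* Derivatives of y and of the exponentials are taken in X, the derivative of u in R. The two
     notions agree except possibly at the maximum of R. *)
  have below: "has_delta_derivative R f d t"
    if "has_delta_derivative X f d t" "t \<in> R" "b \<in> R" "t < b" for f :: "real \<Rightarrow> real" and d t b
  proof (rule has_delta_derivative_subset[OF that(1) R(3)])
    show "fwd_jump R t = fwd_jump X t"
      using that fwd_jump_ts_kappa[of t T b] S unfolding R_def X_def S_def
      by (auto simp: fwd_jump_atLeast)
  qed
  have contX: "continuous (at t within R) f"
    if "has_delta_derivative X f d t" "t \<in> R" for f :: "real \<Rightarrow> real" and d t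
    using has_delta_derivative_continuous[OF R(4) _ that(1)] that(2) R(3) continuous_within_subset by blast
  have ucont: "continuous (at t within R) u" if "t \<in> R" for t
  proof (cases "t \<in> ts_kappa S")
    case True
    then show ?thesis using has_delta_derivative_continuous[OF R(1) that uD] that by (simp add: R_def)
  next
    case False
    with that ts_kappa_isolated[of t S] have "at t within S = bot" by (auto simp: R_def)
    then have "at t within R = bot" using at_le[of R S t] by (simp add: R_def bot_unique)
    then show ?thesis by (simp add: continuous_within)
  qed
  have factor: "u b + c * y b = (u t0 + c * y t0) * e b"
    if c: "c\<^sup>2 = \<gamma>\<^sup>2" and e: "e t0 = 1" "\<And>t. t \<in> T \<Longrightarrow> t0 \<le> t \<Longrightarrow> e t \<noteq> 0"
      "\<And>t. t \<in> S \<Longrightarrow> t0 \<le> t \<Longrightarrow> has_delta_derivative X e (conf_rate \<kappa>0 \<kappa>1 \<alpha> (\<lambda>_. c) t * e t) t"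
      and b: "b \<in> R" for c e b
  proof -
    have eR: "has_delta_derivative X e (conf_rate \<kappa>0 \<kappa>1 \<alpha> (\<lambda>_. c) t * e t) t" if "t \<in> R" for t
      using e(3) that by (simp add: R_def)
    have "(u b + c * y b) / e b = (u t0 + c * y t0) / e t0"
    proof (rule delta_linear_unique[OF R(1,2) b, where q = "conf_rate \<kappa>0 \<kappa>1 \<alpha> (\<lambda>_. c)"])
      fix t assume t: "t \<in> R" "t0 \<le> t" "t < b"
      then have tk: "t \<in> ts_kappa S" using b ts_kappaI[of t S b] by (simp add: R_def)
      have "has_delta_derivative R (\<lambda>t. u t + c * y t) (du t + c * dy t) t"
        using t b tk
        by (intro has_delta_derivative_add[OF R(1)] has_delta_derivative_linear[OF bounded_linear_mult_right R(1)]
              uD below[OF yD]) auto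
      moreover have "du t + c * dy t = conf_rate \<kappa>0 \<kappa>1 \<alpha> (\<lambda>_. c) t *\<^sub>R (u t + c * y t)"
        unfolding du_def dy_def conf_rate_def c[symmetric]
        by (simp add: add_divide_distrib[symmetric] algebra_simps power2_eq_square)
      ultimately show "has_delta_derivative R (\<lambda>t. u t + c * y t) (conf_rate \<kappa>0 \<kappa>1 \<alpha> (\<lambda>_. c) t *\<^sub>R (u t + c * y t)) t"
        by simp
      show "has_delta_derivative R e (conf_rate \<kappa>0 \<kappa>1 \<alpha> (\<lambda>_. c) t *\<^sub>R e t) t"
        using below[OF eR[OF t(1)] t(1) b t(3)] by simp
    next
      show "continuous (at b within R) (\<lambda>t. u t + c * y t)"
        by (intro continuous_intros ucont contX[OF yD] b)
      show "continuous (at b within R) e" by (rule contX[OF eR[OF b] b])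
    next
      show "e t \<noteq> 0" if "t \<in> R" for t using that e(2) R(3) by (auto simp: X_def)
    qed (use b in \<open>simp add: R_def\<close>)
    moreover have "e b \<noteq> 0" using b e(2) R(3) by (auto simp: X_def)
    ultimately show ?thesis using e(1) by (simp add: field_simps)
  qed
  define A where "A = (u t0 + \<gamma> * y t0) / (2 * \<gamma>)"
  define B where "B = (\<gamma> * y t0 - u t0) / (2 * \<gamma>)"
  have plus: "u t + \<gamma> * y t = 2 * \<gamma> * A * p t" if "t \<in> R" for t
  proof -
    have "u t + \<gamma> * y t = (u t0 + \<gamma> * y t0) * p t"
      using that p by (intro factor) (auto simp: S_def X_def)
    then show ?thesis using \<open>\<gamma> \<noteq> 0\<close> by (simp add: A_def)
  qed
  have minus: "u t - \<gamma> * y t = - (2 * \<gamma> * B * m t)" if "t \<in> R" for t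
  proof -
    have "u t + (- \<gamma>) * y t = (u t0 + (- \<gamma>) * y t0) * m t"
      using that m by (intro factor) (auto simp: S_def X_def)
    then show ?thesis using \<open>\<gamma> \<noteq> 0\<close> by (simp add: B_def left_diff_distrib)
  qed
  have onR: "y t = A * p t + B * m t" if "t \<in> R" for t
  proof -
    have "2 * \<gamma> * y t = 2 * \<gamma> * (A * p t + B * m t)"
      using plus[OF that] minus[OF that] by (simp add: algebra_simps)
    then show ?thesis using \<open>\<gamma> \<noteq> 0\<close> by simp
  qed
  have "y t = A * p t + B * m t" if t: "t \<in> T" "t0 \<le> t" for t
  proof (cases "t \<in> S")
    case True
    with t onR show ?thesis by (simp add: R_def)
  next
    case False
    then have max: "\<And>s. s \<in> T \<Longrightarrow> s \<le> t" and ls: "bwd_jump T t < t"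
      using t by (auto simp: S_def ts_kappa_def left_scattered_def)
    (* t is the maximum of T and isolated. Its predecessor r lies in R, and at r the functions
       y, p and m all make the step prescribed by their delta derivatives. *)
    have "t0 < t" using t False S by (cases "t = t0") auto
    define r where "r = bwd_jump T t"
    have ne: "T \<inter> {..<t} \<noteq> {}" using \<open>t0 < t\<close> S by auto
    have bdd: "bdd_above (T \<inter> {..<t})" by (rule bdd_aboveI[of _ t]) auto
    have "{s \<in> T. s < t} = T \<inter> {..<t}" by auto
    then have r_Sup: "r = Sup (T \<inter> {..<t})" using ne by (simp only: r_def bwd_jump_def if_False)
    have "r \<in> closure (T \<inter> {..<t})" unfolding r_Sup by (rule closure_contains_Sup[OF ne bdd])
    moreover have "closure (T \<inter> {..<t}) \<subseteq> T" using T by (intro closure_minimal) auto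
    ultimately have rT: "r \<in> T" by auto
    have up: "s \<le> r" if "s \<in> T" "s < t" for s
      unfolding r_Sup using that bdd by (intro cSup_upper) auto
    have r: "r \<in> R" "t0 \<le> r" "r \<in> S" "r \<in> X" "r < t"
      using up[OF S(4) \<open>t0 < t\<close>] ls rT t ts_kappaI[OF rT t(1)] by (auto simp: R_def S_def r_def X_def)
    have "fwd_jump T r = t" using t r up by (intro fwd_jump_eqI) force+
    then have jump: "fwd_jump X r = t" using r rT by (simp add: X_def fwd_jump_atLeast)
    define h where "h = graininess X r"
    have yt: "y t = y r + h * dy r"
      using has_delta_derivative_jump[OF R(4) r(4) yD[OF r(1)]] by (simp add: jump h_def)
    have "has_delta_derivative X p (conf_rate \<kappa>0 \<kappa>1 \<alpha> (\<lambda>_. \<gamma>) r * p r) r"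
      using p(3) r by (simp add: X_def S_def)
    from has_delta_derivative_jump[OF R(4) r(4) this]
    have pt: "p t = p r + h * (conf_rate \<kappa>0 \<kappa>1 \<alpha> (\<lambda>_. \<gamma>) r * p r)"
      by (simp add: jump h_def)
    have "has_delta_derivative X m (conf_rate \<kappa>0 \<kappa>1 \<alpha> (\<lambda>_. - \<gamma>) r * m r) r"
      using m(3) r by (simp add: X_def S_def)
    from has_delta_derivative_jump[OF R(4) r(4) this]
    have mt: "m t = m r + h * (conf_rate \<kappa>0 \<kappa>1 \<alpha> (\<lambda>_. - \<gamma>) r * m r)"
      by (simp add: jump h_def)
    have ur: "u r = \<gamma> * (A * p r - B * m r)"
      using plus[OF r(1)] minus[OF r(1)] by (simp add: algebra_simps)
    have "dy r = A * (conf_rate \<kappa>0 \<kappa>1 \<alpha> (\<lambda>_. \<gamma>) r * p r) + B * (conf_rate \<kappa>0 \<kappa>1 \<alpha> (\<lambda>_. - \<gamma>) r * m r)"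
      unfolding dy_def conf_rate_def onR[OF r(1)] ur
      using k0[OF rT] by (simp add: field_simps)
    then show ?thesis unfolding yt pt mt onR[OF r(1)] by (simp add: algebra_simps)
  qed
  then show ?thesis by blast
qed

theorem theorem3p24:
  fixes T :: "real set" and \<kappa>0 \<kappa>1 :: "real \<Rightarrow> real \<Rightarrow> real" and \<alpha> t0 \<gamma> :: real
  assumes "time_scale T"
    and "0 < \<alpha>" and "\<alpha> \<le> 1"
    and "t0 \<in> ts_kappa T"
    and "\<gamma> \<noteq> 0"
    and "admissible_pair T \<kappa>0 \<kappa>1"
    and "\<forall>t\<in>ts_kappa T.
           (\<kappa>0 \<alpha> t)\<^sup>2 - 2 * graininess T t * \<kappa>0 \<alpha> t * \<kappa>1 \<alpha> t
             + (graininess T t)\<^sup>2 * (- \<gamma>\<^sup>2 + (\<kappa>1 \<alpha> t)\<^sup>2) \<noteq> 0"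
    \<comment> \<open>the rates are in the domain of the exponential function: this can only fail if
        \<open>\<kappa>0 \<alpha>\<close> has left-sided limit 0 at some left-dense point\<close>
    and "rd_continuous T (conf_rate \<kappa>0 \<kappa>1 \<alpha> (\<lambda>_. \<gamma>))"
    and "rd_continuous T (conf_rate \<kappa>0 \<kappa>1 \<alpha> (\<lambda>_. - \<gamma>))"
    \<comment> \<open>rd-continuity imposes nothing at a left-dense maximum, where the equation is
        nevertheless required to hold; vacuous if \<open>T\<close> is unbounded above\<close>
    and "\<forall>m\<in>ts_kappa T. (\<forall>s\<in>ts_kappa T. s \<le> m) \<and> left_dense (ts_kappa T) m \<longrightarrow>
           continuous (at m within ts_kappa T) (\<kappa>0 \<alpha>) \<and>
           continuous (at m within ts_kappa T) (\<kappa>1 \<alpha>)"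
  shows
    "(\<forall>c1 c2 :: real. \<exists>y :: real \<Rightarrow> real.
        (\<forall>t \<in> T \<inter> {t0..}. complex_of_real (y t) =
           of_real c1 * conf_cosh T \<kappa>0 \<kappa>1 \<alpha> \<gamma> t t0 + of_real c2 * conf_sinh T \<kappa>0 \<kappa>1 \<alpha> \<gamma> t t0) \<and>
        conf_solution T \<kappa>0 \<kappa>1 \<alpha> \<gamma> t0 y) \<and>
     (\<forall>y :: real \<Rightarrow> real. conf_solution T \<kappa>0 \<kappa>1 \<alpha> \<gamma> t0 y \<longrightarrow>
        (\<exists>c1 c2 :: real. \<forall>t \<in> T \<inter> {t0..}. complex_of_real (y t) =
           of_real c1 * conf_cosh T \<kappa>0 \<kappa>1 \<alpha> \<gamma> t t0 + of_real c2 * conf_sinh T \<kappa>0 \<kappa>1 \<alpha> \<gamma> t t0))"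
proof -
  note adm = assms(6)[unfolded admissible_pair_def]
  have T: "closed T" using assms(1) by (simp add: time_scale_def)
  have k0: "\<kappa>0 \<alpha> t \<noteq> 0" if "t \<in> T" for t
    using adm assms(2,3) that by auto
  let ?q = "\<lambda>c. conf_rate \<kappa>0 \<kappa>1 \<alpha> (\<lambda>_. c)"
  have qmax: "continuous (at x within ts_kappa T) (?q c)"
    if x: "x \<in> ts_kappa T" "\<And>s. s \<in> ts_kappa T \<Longrightarrow> s \<le> x" "left_dense (ts_kappa T) x" for x c
  proof -
    have "\<kappa>0 \<alpha> x \<noteq> 0" using x(1) k0 ts_kappa_subset by blast
    moreover have "continuous (at x within ts_kappa T) (\<kappa>0 \<alpha>)" "continuous (at x within ts_kappa T) (\<kappa>1 \<alpha>)"
      using assms(10) x by blast+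
    ultimately show ?thesis
      unfolding conf_rate_def continuous_within by (intro tendsto_intros) auto
  qed
  have reg: "1 + graininess T t * ?q c t \<noteq> 0" if t: "t \<in> ts_kappa T" and c: "c\<^sup>2 = \<gamma>\<^sup>2" for t c
  proof
    assume 0: "1 + graininess T t * ?q c t = 0"
    have "\<kappa>0 \<alpha> t \<noteq> 0" using t k0 ts_kappa_subset by blast
    with 0 have "\<kappa>0 \<alpha> t - graininess T t * \<kappa>1 \<alpha> t = - graininess T t * c"
      by (simp add: conf_rate_def field_simps)
    (* The assumed nonvanishing quantity is (k0 - mu k1)^2 - mu^2 gamma^2. *)
    then have "(\<kappa>0 \<alpha> t - graininess T t * \<kappa>1 \<alpha> t)\<^sup>2 = (graininess T t)\<^sup>2 * \<gamma>\<^sup>2"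
      by (simp add: power_mult_distrib c)
    then show False using assms(7) t by (simp add: power2_eq_square algebra_simps)
  qed
  obtain p where p: "p t0 = 1"
      "\<And>t. t \<in> T \<Longrightarrow> t0 \<le> t \<Longrightarrow> ts_exp T (?q \<gamma>) t t0 = of_real (p t)"
      "\<And>t. t \<in> T \<Longrightarrow> t0 \<le> t \<Longrightarrow> p t \<noteq> 0"
      "\<And>t. t \<in> ts_kappa T \<Longrightarrow> t0 \<le> t \<Longrightarrow> has_delta_derivative (T \<inter> {t0..}) p (?q \<gamma> t * p t) t"
      "\<And>t. t \<in> ts_kappa (ts_kappa T) \<Longrightarrow> t0 \<le> t \<Longrightarrow>
         has_delta_derivative (ts_kappa T \<inter> {t0..}) p (?q \<gamma> t * p t) t"
    using ts_exp_forward[OF T assms(4,8) qmax reg] by blast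
  obtain m where m: "m t0 = 1"
      "\<And>t. t \<in> T \<Longrightarrow> t0 \<le> t \<Longrightarrow> ts_exp T (?q (- \<gamma>)) t t0 = of_real (m t)"
      "\<And>t. t \<in> T \<Longrightarrow> t0 \<le> t \<Longrightarrow> m t \<noteq> 0"
      "\<And>t. t \<in> ts_kappa T \<Longrightarrow> t0 \<le> t \<Longrightarrow> has_delta_derivative (T \<inter> {t0..}) m (?q (- \<gamma>) t * m t) t"
      "\<And>t. t \<in> ts_kappa (ts_kappa T) \<Longrightarrow> t0 \<le> t \<Longrightarrow>
         has_delta_derivative (ts_kappa T \<inter> {t0..}) m (?q (- \<gamma>) t * m t) t"
    using ts_exp_forward[OF T assms(4,9) qmax reg] by auto
  (* The change of basis between (cosh, sinh) and the two exponentials. *)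
  have hyp: "of_real c1 * conf_cosh T \<kappa>0 \<kappa>1 \<alpha> \<gamma> t t0 + of_real c2 * conf_sinh T \<kappa>0 \<kappa>1 \<alpha> \<gamma> t t0 =
      complex_of_real ((c1 + c2) / 2 * p t + (c1 - c2) / 2 * m t)" if "t \<in> T" "t0 \<le> t" for c1 c2 t
    using that by (simp add: conf_cosh_def conf_sinh_def conf_exp_def p(2) m(2) field_simps)
  show ?thesis
  proof (intro conjI allI impI)
    fix c1 c2 :: real
    have "conf_solution T \<kappa>0 \<kappa>1 \<alpha> \<gamma> t0 (\<lambda>t. (c1 + c2) / 2 * p t + (c1 - c2) / 2 * m t)"
      using T k0 p(4,5) m(4,5) by (rule exp_combination_is_conf_solution)
    then show "\<exists>y. (\<forall>t \<in> T \<inter> {t0..}. complex_of_real (y t) =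
           of_real c1 * conf_cosh T \<kappa>0 \<kappa>1 \<alpha> \<gamma> t t0 + of_real c2 * conf_sinh T \<kappa>0 \<kappa>1 \<alpha> \<gamma> t t0) \<and>
        conf_solution T \<kappa>0 \<kappa>1 \<alpha> \<gamma> t0 y"
      using hyp by (intro exI conjI ballI) auto
  next
    fix y assume "conf_solution T \<kappa>0 \<kappa>1 \<alpha> \<gamma> t0 y"
    with T assms(4,5) k0 p(1,3,4) m(1,3,4)
    have "\<exists>a b. \<forall>t\<in>T. t0 \<le> t \<longrightarrow> y t = a * p t + b * m t"
      by (rule conf_solution_is_exp_combination)
    then obtain a b where ab: "\<And>t. t \<in> T \<Longrightarrow> t0 \<le> t \<Longrightarrow> y t = a * p t + b * m t"
      by blast
    show "\<exists>c1 c2 :: real. \<forall>t \<in> T \<inter> {t0..}. complex_of_real (y t) =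
           of_real c1 * conf_cosh T \<kappa>0 \<kappa>1 \<alpha> \<gamma> t t0 + of_real c2 * conf_sinh T \<kappa>0 \<kappa>1 \<alpha> \<gamma> t t0"
      using ab hyp[of _ "a + b" "a - b"] by (intro exI[of _ "a + b"] exI[of _ "a - b"]) auto
  qed
qed

end
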